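(* Let $\lambda\in\mathbb{C}$ with $\lambda\notin\mathbb{Z}_{<0}$. The Dirichlet series $$D(s_1,s_2;\lambda)=\sum_{k=1}^{\infty}\frac{\zeta(s_1+k)-1}{(k+\lambda)^{s_2}}$$ converges absolutely for all $s_1,s_2\in\mathbb{C}$ except when $s_1\in\{0,-1,-2,\dots\}$. Moreover, it admits the integral representation $$D(s_1,s_2;\lambda)=\frac{e^{-\pi i s_2}\,\Gamma(1-s_2)}{2\pi i\,\bigl(e^{2\pi i s_1}-1\bigr)}\int_{+\infty}^{(0+)}\int_{+\infty}^{(0+)}\frac{v^{s_1-1}w^{s_2-1}}{e^{v+\lambda w}(e^{v}-1)}\sum_{k=1}^{\infty}\frac{(v/e^{w})^{k}}{\Gamma(s_1+k)}\,dv\,dw .$$ This representation also defines a holomorphic function of $(s_1,s_2)\in\mathbb{C}^2$, except for $s_1\in\{0,-1,-2,\dots\}$.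
   Context: $\zeta$ is the Riemann zeta function and $\Gamma$ the gamma function. The power $(k+\lambda)^{s_2}$ is taken with the principal branch of the logarithm. The symbol $\int_{+\infty}^{(0+)}$ denotes integration along a Hankel contour, which starts at positive infinity on the real axis, encircles the origin counterclockwise with a small radius, and returns to the starting point; along it the argument of the integration variable ($v$ or $w$) runs from $0$ to $2\pi$, which fixes the branches of $v^{s_1-1}$ and $w^{s_2-1}$. At parameters where the prefactor on the right-hand side is singular ($s_1\in\mathbb{N}$ or $s_2\in\mathbb{N}$, $\mathbb{N}=\{1,2,\dots\}$), the singularities are apparent ones, cancelled by vanishing of the integrals, and the right-hand side is understood by its holomorphic extension.
   Formalization: The displayed double integral is asserted literally only for Re λ > −1, since the w-integral generally diverges otherwise; for other λ its right side means the analytic continuation in λ to the plane slit along (−∞,−1], with values from above at non-integer points of the cut. *)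

theory Defs
  imports "HOL-Complex_Analysis.Complex_Analysis"
begin

(* The Riemann zeta function as the analytic continuation of its Dirichlet series.
   By the identity theorem the conditions fix it everywhere except at the pole 1,
   where the value is arbitrary. *)
definition zeta :: "complex \<Rightarrow> complex" where
  "zeta = (SOME f. f holomorphic_on (- {1}) \<and>
     (\<forall>s. Re s > 1 \<longrightarrow> (\<lambda>n. 1 / of_nat (Suc n) powr s) sums f s))"

definition D_term :: "complex \<Rightarrow> complex \<Rightarrow> complex \<Rightarrow> nat \<Rightarrow> complex" where
  "D_term s1 s2 lam k = (zeta (s1 + of_nat k) - 1) / (of_nat k + lam) powr s2"

(* The sum starts at index 1. *)
definition D_series :: "complex \<Rightarrow> complex \<Rightarrow> complex \<Rightarrow> complex" where
  "D_series s1 s2 lam = (\<Sum>k. D_term s1 s2 lam (Suc k))"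

(* Hankel contour of radius r, parametrized by the real line: in along the positive axis
   (t < 0, argument 0), once around the circle (0 <= t <= 2 pi, argument t), and out along
   the positive axis (t > 2 pi, argument 2 pi). To carry the branch, we record the logarithm
   of the integration variable, whose imaginary part is the argument running from 0 to 2 pi;
   the variable itself is exp (hankel_log r t). *)
definition hankel_log :: "real \<Rightarrow> real \<Rightarrow> complex" where
  "hankel_log r t =
     (if t < 0 then of_real (ln (r - t))
      else if t \<le> 2 * pi then of_real (ln r) + \<i> * of_real t
      else of_real (ln (r + (t - 2 * pi))) + 2 * of_real pi * \<i>)"

(* Derivative of exp (hankel_log r t) in t. *)
definition hankel_deriv :: "real \<Rightarrow> real \<Rightarrow> complex" where
  "hankel_deriv r t =
     (if t < 0 then - 1
      else if t \<le> 2 * pi then \<i> * of_real r * exp (\<i> * of_real t)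
      else 1)"

(* Integrands are functions of the logarithm p of the integration variable v = exp p,
   so that v to the power a on the chosen branch is exp (a * p). *)
definition hankel_integrable :: "real \<Rightarrow> (complex \<Rightarrow> complex) \<Rightarrow> bool" where
  "hankel_integrable r g \<longleftrightarrow>
     integrable lborel (\<lambda>t. g (hankel_log r t) * hankel_deriv r t)"

definition hankel_integral :: "real \<Rightarrow> (complex \<Rightarrow> complex) \<Rightarrow> complex" where
  "hankel_integral r g = (LINT t|lborel. g (hankel_log r t) * hankel_deriv r t)"

(* Here p = log v and q = log w. *)
definition kernel :: "complex \<Rightarrow> complex \<Rightarrow> complex \<Rightarrow> complex \<Rightarrow> complex \<Rightarrow> complex" where
  "kernel s1 s2 lam p q =
     (let v = exp p; w = exp q in
        exp ((s1 - 1) * p) * exp ((s2 - 1) * q) / (exp (v + lam * w) * (exp v - 1)) *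
        (\<Sum>k. (v / exp w) ^ Suc k / Gamma (s1 + of_nat (Suc k))))"

definition double_hankel_converges ::
    "real \<Rightarrow> real \<Rightarrow> complex \<Rightarrow> complex \<Rightarrow> complex \<Rightarrow> bool" where
  "double_hankel_converges rv rw s1 s2 lam \<longleftrightarrow>
     (\<forall>t. hankel_integrable rv (\<lambda>p. kernel s1 s2 lam p (hankel_log rw t))) \<and>
     hankel_integrable rw (\<lambda>q. hankel_integral rv (\<lambda>p. kernel s1 s2 lam p q))"

definition hankel_rep :: "real \<Rightarrow> real \<Rightarrow> complex \<Rightarrow> complex \<Rightarrow> complex \<Rightarrow> complex" where
  "hankel_rep rv rw s1 s2 lam =
     exp (- of_real pi * \<i> * s2) * Gamma (1 - s2) /
       (2 * of_real pi * \<i> * (exp (2 * of_real pi * \<i> * s1) - 1)) *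
     hankel_integral rw (\<lambda>q. hankel_integral rv (\<lambda>p. kernel s1 s2 lam p q))"

(* Joint holomorphy in two variables: the (real Frechet) derivative exists and is
   complex linear. *)
definition holomorphic2_on ::
    "(complex \<Rightarrow> complex \<Rightarrow> complex) \<Rightarrow> (complex \<times> complex) set \<Rightarrow> bool" where
  "holomorphic2_on f U \<longleftrightarrow>
     (\<forall>x\<in>U. \<exists>a b. ((\<lambda>z. f (fst z) (snd z)) has_derivative (\<lambda>h. a * fst h + b * snd h))
        (at x within U))"

(* R s1 s2 lam is the right-hand side understood by holomorphic extension.
   The integral converges for Re lam > -1, and there R is its holomorphic extension across the
   parameters where the prefactor is singular. For general lam the integral over w diverges at
   infinity (the integrand decays only like exp (- (lam + 1) w)), and R is the holomorphic
   continuation in lam to the plane slit along the reals <= -1. On the slit, away from the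
   negative integers, R is continuous from above, as is the principal branch of
   (k + lam) powr s2. These conditions determine R whenever s1 is not in {0, -1, -2, ...} and
   lam is not a negative integer. *)
definition rep_extension :: "(complex \<Rightarrow> complex \<Rightarrow> complex \<Rightarrow> complex) \<Rightarrow> bool" where
  "rep_extension R \<longleftrightarrow>
     (\<exists>\<epsilon>>0. \<forall>rv\<in>{0<..<\<epsilon>}. \<forall>rw\<in>{0<..<\<epsilon>}. \<forall>s1 s2 lam.
        s1 \<notin> \<int> \<longrightarrow> s2 \<notin> of_nat ` {1..} \<longrightarrow> Re lam > -1 \<longrightarrow>
        R s1 s2 lam = hankel_rep rv rw s1 s2 lam) \<and>
     (\<forall>lam. Re lam > -1 \<longrightarrow>
        holomorphic2_on (\<lambda>s1 s2. R s1 s2 lam) ((- \<int>\<^sub>\<le>\<^sub>0) \<times> UNIV)) \<and>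
     (\<forall>s1 s2. s1 \<notin> \<int>\<^sub>\<le>\<^sub>0 \<longrightarrow>
        (\<lambda>lam. R s1 s2 lam) holomorphic_on (- (of_real ` {..-1})) \<and>
        (\<forall>x::real. x < -1 \<longrightarrow> x \<notin> \<int> \<longrightarrow>
           ((\<lambda>lam. R s1 s2 lam) \<longlongrightarrow> R s1 s2 (of_real x))
             (at (of_real x) within {lam. Im lam > 0})))"

end

theory Submission
  imports Defs
begin

text \<open>
  For Re s > 1 a Hankel integral of v powr (s - 1) * h v collapses onto the positive half-line with
  the factor exp (2 pi i s) - 1. Both sides of the resulting identities being holomorphic in s, the
  choice h v = exp (- a v) gives a powr (- s) and h v = exp (- v) / (exp v - 1) gives zeta s - 1 for
  all s; the second identity also shows that zeta has an analytic continuation at all. Expanding the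
  kernel of the double integral in powers of v / exp w and integrating term by term (1 / Gamma (s + k)
  decays almost like 1 / k!) turns it into the Dirichlet series. As zeta (s + k) - 1 is of order
  2 powr (- k), the terms of the series are geometrically small, locally uniformly in all three
  parameters, so the series itself is the required holomorphic extension.
\<close>

section \<open>Integrals over Hankel contours\<close>

text \<open>The weights \<open>1 / Gamma (s1 + k)\<close> are what lets zeta come out with one
  common factor: the \<open>v\<close>-integral of the k-th term carries
  \<open>rGamma (1 - s1 - k)\<close>, the reflection formula merges the two reciprocal gammas into a
  sine, hence into \<open>exp (2 pi i (s1 + k)) - 1\<close>, and by periodicity this does not depend
  on \<open>k\<close>. Using \<open>rGamma\<close> instead of quotients by \<open>Gamma\<close>
  keeps the identities free of artificial poles, so they can be continued from Re s > 1. The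
  collapse needs that half-plane because a simple pole of h at 0 leaves a power Re s - 2 of the
  radius. The obstacle is the exchange of sum and integrals. On the small circle Re w can be
  negative, so exp (- w) can exceed 1 and the series in v / exp w may outgrow exp v. Radii below 1/4
  bound exp (- w) by 4/3, and a growth rate of 5/4 * 4/3 = 5/3 stays below the decay rate 2 of exp
  (- v) / (exp v - 1). In w, each term has at least one factor exp (- w); setting it aside gives the
  decay exp (- (lam + 1) w), integrable exactly because Re lam > -1.\<close>

lemma deriv_norm_le_of_bound:
  assumes "f holomorphic_on ball z d" "0 < d" "y \<in> ball z (d/2)"
    and "\<And>x. x \<in> ball z d \<Longrightarrow> norm (f x) \<le> B"
  shows "norm (deriv f y) \<le> 4 * B / d"
proof -
  have sub: "cball y (d/4) \<subseteq> ball z d"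
  proof
    fix x assume "x \<in> cball y (d/4)"
    then show "x \<in> ball z d"
      using assms(2,3) dist_triangle[of z x y] by (auto simp: dist_commute)
  qed
  \<comment> \<open>Cauchy's estimate on the circle of radius d/4 about \<open>y\<close>. As
    \<open>y\<close> is within d/2 of \<open>z\<close>, the closed disc stays inside
    \<open>ball z d\<close>; the factor 4 comes from this radius.\<close>
  have "norm ((deriv ^^ 1) f y) \<le> fact 1 * B / (d/4) ^ 1"
  proof (rule Cauchy_inequality)
    show "f holomorphic_on ball y (d/4)"
      using sub ball_subset_cball by (intro holomorphic_on_subset[OF assms(1)]) fast
    show "continuous_on (cball y (d/4)) f"
      using sub assms(1) holomorphic_on_imp_continuous_on continuous_on_subset by blast
    show "norm (f x) \<le> B" if "norm (y - x) = d/4" for x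
      using that sub by (intro assms(4)) (auto simp: dist_norm)
  qed (use assms in auto)
  then show ?thesis by (simp add: field_simps)
qed

text \<open>A majorant of \<open>f\<close> alone suffices: Cauchy's estimate turns it into a
  majorant of the derivative in \<open>z\<close>, the mean value inequality into one of the
  difference quotients, and dominated convergence along sequences then gives complex
  differentiability.\<close>

lemma holomorphic_on_integral:
  fixes f :: "complex \<Rightarrow> 'a \<Rightarrow> complex"
  assumes "open S"
    and meas: "\<And>z. z \<in> S \<Longrightarrow> f z \<in> borel_measurable M"
    and hol: "\<And>t. t \<in> space M \<Longrightarrow> (\<lambda>z. f z t) holomorphic_on S"
    and dom: "\<And>z0. z0 \<in> S \<Longrightarrow> \<exists>d>0. \<exists>g. integrable M g \<and>
       (\<forall>z\<in>ball z0 d \<inter> S. \<forall>t\<in>space M. norm (f z t) \<le> g t)"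
  shows "(\<lambda>z. LINT t|M. f z t) holomorphic_on S"
proof -
  have "\<exists>D. ((\<lambda>z. LINT t|M. f z t) has_field_derivative D) (at z0)" if z0: "z0 \<in> S" for z0
  proof -
    obtain d0 g where d0: "d0 > 0" and g: "integrable M g"
      and bd0: "\<And>z t. z \<in> ball z0 d0 \<inter> S \<Longrightarrow> t \<in> space M \<Longrightarrow> norm (f z t) \<le> g t"
      using dom[OF z0] by blast
    obtain d1 where d1: "d1 > 0" "ball z0 d1 \<subseteq> S"
      using \<open>open S\<close> z0 openE by blast
    define d where "d = min d0 d1"
    have d: "d > 0" "ball z0 d \<subseteq> S" "\<And>z t. z \<in> ball z0 d \<Longrightarrow> t \<in> space M \<Longrightarrow> norm (f z t) \<le> g t"
      using d0 d1 bd0 unfolding d_def by auto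
    have holb: "(\<lambda>z. f z t) holomorphic_on ball z0 d" if "t \<in> space M" for t
      using hol[OF that] d(2) holomorphic_on_subset by blast
    have int: "integrable M (f z)" if "z \<in> ball z0 d" for z
      using that d by (intro Bochner_Integration.integrable_bound[OF g] meas AE_I2) (auto intro: order_trans[OF d(3)])
    have quot: "norm ((f z t - f z0 t) / (z - z0)) \<le> 4 * g t / d"
      if "z \<in> ball z0 (d/2)" "t \<in> space M" for z t
    proof -
      have "norm (f z t - f z0 t) \<le> (4 * g t / d) * norm (z - z0)"
      proof (rule field_differentiable_bound[where S = "ball z0 (d/2)" and f = "\<lambda>z. f z t"
              and f' = "deriv (\<lambda>z. f z t)"])
        fix y assume y: "y \<in> ball z0 (d/2)"
        have "((\<lambda>z. f z t) has_field_derivative deriv (\<lambda>z. f z t) y) (at y)"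
          using y d(1) by (intro holomorphic_derivI[OF holb[OF that(2)]]) auto
        then show "((\<lambda>z. f z t) has_field_derivative deriv (\<lambda>z. f z t) y) (at y within ball z0 (d/2))"
          by (rule has_field_derivative_at_within)
        show "norm (deriv (\<lambda>z. f z t) y) \<le> 4 * g t / d"
          using y d(1,3) that(2) by (intro deriv_norm_le_of_bound[OF holb[OF that(2)]]) auto
      qed (use that d(1) in auto)
      moreover have "0 \<le> 4 * g t / d"
        using d(1) order_trans[OF norm_ge_zero d(3)[of z0 t]] that by auto
      ultimately show ?thesis
        by (cases "z = z0") (auto simp: norm_divide divide_simps)
    qed
    define D where "D = (\<lambda>t. deriv (\<lambda>z. f z t) z0)"
    have lim: "((\<lambda>z. (f z t - f z0 t) / (z - z0)) \<longlongrightarrow> D t) (at z0)" if "t \<in> space M" for t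
      using holomorphic_derivI[OF holb[OF that], of z0] d(1)
      unfolding D_def has_field_derivative_iff by auto
    have "((\<lambda>z. ((LINT t|M. f z t) - (LINT t|M. f z0 t)) / (z - z0)) \<longlongrightarrow> (LINT t|M. D t)) (at z0)"
      unfolding tendsto_at_iff_sequentially comp_def
    proof (intro allI impI)
      fix X :: "nat \<Rightarrow> complex"
      assume X0: "\<forall>i. X i \<in> UNIV - {z0}" and X: "X \<longlonglongrightarrow> z0"
      have "eventually (\<lambda>i. X i \<in> ball z0 (d/2)) sequentially"
        using X d(1) by (intro topological_tendstoD[OF X]) auto
      then obtain N where N: "\<And>i. i \<ge> N \<Longrightarrow> X i \<in> ball z0 (d/2)"
        by (auto simp: eventually_sequentially)
      have S: "X (i + N) \<in> S" "X (i+N) \<in> ball z0 d" for i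
        using N[of "i+N"] d by auto
      have limX: "(\<lambda>i. (f (X (i+N)) t - f z0 t) / (X (i+N) - z0)) \<longlonglongrightarrow> D t" if "t \<in> space M" for t
      proof -
        have "(\<lambda>i. (f (X i) t - f z0 t) / (X i - z0)) \<longlonglongrightarrow> D t"
          using lim[OF that] X0 X unfolding tendsto_at_iff_sequentially comp_def by blast
        then show ?thesis by (rule LIMSEQ_ignore_initial_segment)
      qed
      have m1: "(\<lambda>t. (f (X (i+N)) t - f z0 t) / (X (i+N) - z0)) \<in> borel_measurable M" for i
        using meas[OF S(1)] meas[OF z0] by auto
      have "(\<lambda>i. LINT t|M. (f (X (i+N)) t - f z0 t) / (X (i+N) - z0)) \<longlonglongrightarrow> (LINT t|M. D t)"
      proof (rule integral_dominated_convergence[where w = "\<lambda>t. 4 * g t / d"])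
        show "D \<in> borel_measurable M"
          by (rule borel_measurable_LIMSEQ_metric[OF m1 limX])
      qed (use m1 limX g quot N in auto)
      then have "(\<lambda>i. ((LINT t|M. f (X (i+N)) t) - (LINT t|M. f z0 t)) / (X (i+N) - z0)) \<longlonglongrightarrow> (LINT t|M. D t)"
        using int[OF S(2)] int[of z0] d(1) by simp
      then show "(\<lambda>i. ((LINT t|M. f (X i) t) - (LINT t|M. f z0 t)) / (X i - z0)) \<longlonglongrightarrow> (LINT t|M. D t)"
        by (rule LIMSEQ_offset[where k=N])
    qed
    then show ?thesis unfolding has_field_derivative_iff by blast
  qed
  then show ?thesis
    by (meson holomorphic_onI field_differentiable_def field_differentiable_at_within)
qed

text \<open>Dominated convergence for series in the form used three times below (Mellin transform,
  \<open>v\<close>-integral, \<open>w\<close>-integral): a single integrable majorant of all partial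
  sums of norms gives every conclusion at once.\<close>

lemma dominated_series:
  fixes f :: "nat \<Rightarrow> 'a \<Rightarrow> complex"
  assumes meas: "\<And>k. f k \<in> borel_measurable M" and w: "integrable M w"
    and bd: "\<And>n x. x \<in> space M \<Longrightarrow> (\<Sum>k<n. norm (f k x)) \<le> w x"
  shows "\<And>k. integrable M (f k)"
    and "\<And>x. x \<in> space M \<Longrightarrow> summable (\<lambda>k. norm (f k x))"
    and "summable (\<lambda>k. LINT x|M. norm (f k x))"
    and "integrable M (\<lambda>x. \<Sum>k. f k x)"
    and "(\<lambda>k. integral\<^sup>L M (f k)) sums (LINT x|M. (\<Sum>k. f k x))"
proof -
  show int: "integrable M (f k)" for k
  proof (rule Bochner_Integration.integrable_bound[OF w meas], rule AE_I2)
    fix x assume "x \<in> space M"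
    then have "(\<Sum>k<Suc k. norm (f k x)) \<le> w x" by (rule bd)
    moreover have "norm (f k x) \<le> (\<Sum>k<Suc k. norm (f k x))"
      by (rule member_le_sum) auto
    ultimately show "norm (f k x) \<le> norm (w x)" by simp
  qed
  show sm: "summable (\<lambda>k. norm (f k x))" if "x \<in> space M" for x
    using bd[OF that] by (intro summableI_nonneg_bounded) auto
  show sm2: "summable (\<lambda>k. LINT x|M. norm (f k x))"
  proof (rule summableI_nonneg_bounded)
    fix n
    have "(\<Sum>k<n. LINT x|M. norm (f k x)) = (LINT x|M. (\<Sum>k<n. norm (f k x)))"
      using int by (intro Bochner_Integration.integral_sum[symmetric]) auto
    also have "\<dots> \<le> integral\<^sup>L M w"
      using int bd w by (intro integral_mono) auto
    finally show "(\<Sum>k<n. LINT x|M. norm (f k x)) \<le> integral\<^sup>L M w" .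
  qed auto
  show "integrable M (\<lambda>x. \<Sum>k. f k x)" "(\<lambda>k. integral\<^sup>L M (f k)) sums (LINT x|M. (\<Sum>k. f k x))"
    using int sm sm2 by (auto intro!: integrable_suminf sums_integral)
qed

section \<open>Growth and decay along the Hankel contour\<close>

lemma exp_Re_hankel_log:
  assumes "r > 0"
  shows "exp (Re (hankel_log r t)) = (if t < 0 then r - t else if t \<le> 2*pi then r else r + (t - 2*pi))"
  using assms by (auto simp: hankel_log_def)

lemma exp_Re_hankel_log_ge:
  assumes "r > 0"
  shows "exp (Re (hankel_log r t)) \<ge> r" "exp (Re (hankel_log r t)) \<ge> \<bar>t\<bar> - 2*pi"
  using assms pi_gt_zero by (auto simp: exp_Re_hankel_log[OF assms] simp del: pi_gt_zero)

lemma hankel_log_bounds: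
  assumes "r > 0"
  shows "0 \<le> Im (hankel_log r t)" "Im (hankel_log r t) \<le> 2*pi"
  by (auto simp: hankel_log_def)

lemma hankel_log_measurable [measurable]: "hankel_log r \<in> borel_measurable borel"
  unfolding hankel_log_def by measurable

lemma hankel_deriv_measurable [measurable]: "hankel_deriv r \<in> borel_measurable borel"
  unfolding hankel_deriv_def by measurable

lemma norm_hankel_deriv_le: "r > 0 \<Longrightarrow> norm (hankel_deriv r t) \<le> 1 + r"
  by (auto simp: hankel_deriv_def norm_mult)

lemma integrable_exp_neg_abs:
  assumes "c > (0::real)"
  shows "integrable lborel (\<lambda>t. exp (- c * \<bar>t\<bar>))"
proof -
  have "((\<lambda>x. exp (-c*x)) has_integral exp (-c*0)/c) {0..}"
    by (rule has_integral_exp_minus_to_infinity[OF assms])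
  then have "(\<lambda>x. exp (-c*x)) absolutely_integrable_on {0..}"
    by (intro nonnegative_absolutely_integrable_1) auto
  then have 1: "integrable lborel (\<lambda>x. indicator {0..} x *\<^sub>R exp (-c*x))"
    unfolding set_integrable_def by (subst (asm) integrable_completion) auto
  have 2: "integrable lborel (\<lambda>x. indicator {0..} (0 + (-1)*x) *\<^sub>R exp (-c*(0 + (-1)*x)))"
    by (rule lborel_integrable_real_affine[OF 1]) auto
  show ?thesis
    by (rule Bochner_Integration.integrable_bound[OF Bochner_Integration.integrable_add[OF 1 2]])
       (auto simp: indicator_def)
qed

text \<open>The modulus of the variable is at least |t| - 2 pi along the whole contour, so decay in
  the modulus is decay in the parameter \<open>t\<close>, at the cost of a factor
  \<open>exp (2*pi*c)\<close>.\<close>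

lemma integrable_exp_neg_hankel:
  assumes "c > 0" "r > 0"
  shows "integrable lborel (\<lambda>t. C * exp (- c * exp (Re (hankel_log r t))))"
proof (rule Bochner_Integration.integrable_bound)
  show "integrable lborel (\<lambda>t. \<bar>C\<bar> * exp (2*pi*c) * exp (- c * \<bar>t\<bar>))"
    using integrable_exp_neg_abs[OF assms(1)] by simp
  show "AE t in lborel. norm (C * exp (- c * exp (Re (hankel_log r t)))) \<le> norm (\<bar>C\<bar> * exp (2*pi*c) * exp (- c * \<bar>t\<bar>))"
  proof (rule AE_I2)
    fix t :: real
    have "c * (\<bar>t\<bar> - 2*pi) \<le> c * exp (Re (hankel_log r t))"
      using exp_Re_hankel_log_ge[OF assms(2)] assms by (intro mult_left_mono) auto
    then have "exp (- c * exp (Re (hankel_log r t))) \<le> exp (2*pi*c + - c * \<bar>t\<bar>)"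
      by (simp add: algebra_simps)
    then show "norm (C * exp (- c * exp (Re (hankel_log r t)))) \<le> norm (\<bar>C\<bar> * exp (2*pi*c) * exp (- c * \<bar>t\<bar>))"
      by (auto simp: abs_mult exp_add[symmetric] mult.assoc intro!: mult_left_mono)
  qed
qed measurable

text \<open>A power of the variable is absorbed by an arbitrarily slow exponential, uniformly for
  exponents of modulus at most \<open>M\<close>. The summand 2 pi bounds the argument on the
  contour.\<close>

lemma exp_ln_growth:
  fixes M \<delta> r :: real
  assumes "M \<ge> 0" "\<delta> > 0" "r > 0"
  obtains C where "C > 0" "\<And>\<rho>. \<rho> \<ge> r \<Longrightarrow> exp (M * (\<bar>ln \<rho>\<bar> + 2*pi)) \<le> C * exp (\<delta> * \<rho>)"
proof -
  \<comment> \<open>Chosen so that the linear bound ln (a \<rho>) <= a \<rho> - 1, once multiplied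
    by \<open>M\<close>, costs at most \<delta> \<rho>. The denominator \<open>M + 1\<close> also
    covers M = 0.\<close>
  define a where "a = \<delta> / (M + 1)"
  have a: "a > 0" "M * a \<le> \<delta>"
    using assms by (auto simp: a_def field_simps)
  define C where "C = exp (M * (\<bar>ln r\<bar> + \<bar>ln a\<bar> + 2*pi))"
  have "exp (M * (\<bar>ln \<rho>\<bar> + 2*pi)) \<le> C * exp (\<delta> * \<rho>)" if "\<rho> \<ge> r" for \<rho>
  proof -
    have \<rho>: "\<rho> > 0" using that assms by auto
    have "ln (a * \<rho>) \<le> a * \<rho> - 1" using \<rho> a by (intro ln_le_minus_one) auto
    then have 1: "ln \<rho> \<le> a * \<rho> + \<bar>ln a\<bar>" using \<rho> a by (simp add: ln_mult)
    have 2: "- ln \<rho> \<le> \<bar>ln r\<bar>" using that assms ln_mono[of r \<rho>] by linarith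
    have "\<bar>ln \<rho>\<bar> \<le> a * \<rho> + \<bar>ln a\<bar> + \<bar>ln r\<bar>"
      using 1 2 mult_pos_pos[OF a(1) \<rho>] by linarith
    then have "M * (\<bar>ln \<rho>\<bar> + 2*pi) \<le> M * (a * \<rho> + \<bar>ln a\<bar> + \<bar>ln r\<bar> + 2*pi)"
      using assms by (intro mult_left_mono) auto
    also have "\<dots> = M * a * \<rho> + M * (\<bar>ln r\<bar> + \<bar>ln a\<bar> + 2*pi)" by (simp add: algebra_simps)
    also have "M * a * \<rho> \<le> \<delta> * \<rho>" using a \<rho> by (intro mult_right_mono) auto
    finally show ?thesis unfolding C_def by (simp add: exp_add[symmetric] add_ac)
  qed
  moreover have "C > 0" by (simp add: C_def)
  ultimately show ?thesis by (rule that[rotated])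
qed

lemma norm_exp_mult_hankel_log_le:
  fixes s :: complex
  assumes "r > 0" "norm s \<le> M"
  shows "norm (exp (s * hankel_log r t)) \<le> exp (M * (\<bar>Re (hankel_log r t)\<bar> + 2*pi))"
proof -
  have "norm (exp (s * hankel_log r t)) \<le> exp (norm (s * hankel_log r t))"
    by (rule norm_exp)
  also have "norm (s * hankel_log r t) \<le> M * (\<bar>Re (hankel_log r t)\<bar> + \<bar>Im (hankel_log r t)\<bar>)"
    unfolding norm_mult using assms(2) by (intro mult_mono cmod_le) (auto intro: order_trans[OF norm_ge_zero])
  also have "\<dots> \<le> M * (\<bar>Re (hankel_log r t)\<bar> + 2*pi)"
    using hankel_log_bounds[OF assms(1), of t] order_trans[OF norm_ge_zero assms(2)]
    by (intro mult_left_mono add_mono) auto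
  finally show ?thesis by simp
qed

lemma exp_mult_hankel_log_growth:
  fixes M :: real
  assumes "r > 0" "\<delta> > 0"
  obtains C where "C > 0"
    "\<And>(s::complex) t. norm s \<le> M \<Longrightarrow> norm (exp (s * hankel_log r t)) \<le> C * exp (\<delta> * exp (Re (hankel_log r t)))"
proof -
  obtain C where C: "C > 0" "\<And>\<rho>. \<rho> \<ge> r \<Longrightarrow> exp (max 0 M * (\<bar>ln \<rho>\<bar> + 2*pi)) \<le> C * exp (\<delta> * \<rho>)"
    using exp_ln_growth[of "max 0 M" \<delta> r] assms by auto
  show ?thesis
  proof (rule that[OF C(1)])
    fix s :: complex and t assume "norm s \<le> M"
    then have "norm s \<le> max 0 M" by simp
    then show "norm (exp (s * hankel_log r t)) \<le> C * exp (\<delta> * exp (Re (hankel_log r t)))"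
      using order_trans[OF norm_exp_mult_hankel_log_le[OF assms(1)], of s "max 0 M" t] C(2)[OF exp_Re_hankel_log_ge(1)[OF assms(1)], of t]
      by auto
  qed
qed

text \<open>The power of the variable uses up only \<open>c - c'\<close> of the decay rate, which
  may be as small as desired. This supplies the majorants for holomorphy in the exponent and for
  both termwise integrations.\<close>

lemma exp_mult_hankel_log_integrand_bound:
  assumes "r > 0" "c > 0" "c' < c" "\<And>t. norm (g (hankel_log r t)) \<le> K * exp (- c * exp (Re (hankel_log r t)))"
  obtains C where "C \<ge> 0" "\<And>(s::complex) t. norm s \<le> M \<Longrightarrow>
    norm (exp (s * hankel_log r t) * g (hankel_log r t) * hankel_deriv r t) \<le> C * exp (- c' * exp (Re (hankel_log r t)))"
proof -
  obtain C1 where C1: "C1 > 0"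
    "\<And>s t. norm s \<le> M \<Longrightarrow> norm (exp (s * hankel_log r t)) \<le> C1 * exp ((c - c') * exp (Re (hankel_log r t)))"
    using exp_mult_hankel_log_growth[of r "c - c'" M] assms by auto
  have K: "K \<ge> 0"
    using order_trans[OF norm_ge_zero assms(4)[of 0]] by (simp add: zero_le_mult_iff)
  show ?thesis
  proof (rule that[of "C1 * K * (1 + r)"])
    show "C1 * K * (1 + r) \<ge> 0" using K C1 assms by auto
    fix s :: complex and t assume s: "norm s \<le> M"
    let ?n = "exp (Re (hankel_log r t))"
    have "norm (exp (s * hankel_log r t) * g (hankel_log r t) * hankel_deriv r t)
      \<le> (C1 * exp ((c - c') * ?n)) * (K * exp (- c * ?n)) * (1 + r)"
      unfolding norm_mult using K C1 assms(1)
      by (intro mult_mono C1(2)[OF s] assms(4) norm_hankel_deriv_le) auto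
    also have "\<dots> = C1 * K * (1 + r) * (exp ((c - c') * ?n) * exp (- c * ?n))" by (simp add: algebra_simps)
    also have "exp ((c - c') * ?n) * exp (- c * ?n) = exp (- c' * ?n)"
      by (simp add: exp_add[symmetric] algebra_simps)
    finally show "norm (exp (s * hankel_log r t) * g (hankel_log r t) * hankel_deriv r t) \<le> C1 * K * (1 + r) * exp (- c' * ?n)" .
  qed
qed

lemma hankel_integral_holomorphic:
  assumes "r > 0" "c > 0" "\<And>t. norm (g (hankel_log r t)) \<le> K * exp (- c * exp (Re (hankel_log r t)))"
    and [measurable]: "(\<lambda>t. g (hankel_log r t)) \<in> borel_measurable borel"
  shows "(\<lambda>s. hankel_integral r (\<lambda>p. exp ((s - 1) * p) * g p)) holomorphic_on UNIV"
  unfolding hankel_integral_def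
proof (rule holomorphic_on_integral)
  fix s0 :: complex
  obtain C where C: "C \<ge> 0" "\<And>s' t. norm s' \<le> norm (s0 - 1) + 1 \<Longrightarrow>
    norm (exp (s' * hankel_log r t) * g (hankel_log r t) * hankel_deriv r t) \<le> C * exp (- (c/2) * exp (Re (hankel_log r t)))"
    using exp_mult_hankel_log_integrand_bound[OF assms(1,2) _ assms(3), of "c/2" "norm (s0 - 1) + 1"] assms by (auto simp: field_simps)
  show "\<exists>d>0. \<exists>h. integrable lborel h \<and> (\<forall>s\<in>ball s0 d \<inter> UNIV. \<forall>t\<in>space lborel.
      norm (exp ((s - 1) * hankel_log r t) * g (hankel_log r t) * hankel_deriv r t) \<le> h t)"
  proof (intro exI[of _ 1] conjI exI[of _ "\<lambda>t. C * exp (- (c/2) * exp (Re (hankel_log r t)))"] ballI)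
    show "integrable lborel (\<lambda>t. C * exp (- (c/2) * exp (Re (hankel_log r t))))"
      using assms by (intro integrable_exp_neg_hankel) auto
    fix s t assume "s \<in> ball s0 1 \<inter> UNIV"
    then have "norm (s - 1) \<le> norm (s0 - 1) + 1"
      using norm_triangle_ineq[of "s - s0" "s0 - 1"] by (auto simp: dist_norm norm_minus_commute)
    then show "norm (exp ((s - 1) * hankel_log r t) * g (hankel_log r t) * hankel_deriv r t) \<le> C * exp (- (c/2) * exp (Re (hankel_log r t)))"
      by (rule C(2))
  qed auto
  show "(\<lambda>t. exp ((s0 - 1) * hankel_log r t) * g (hankel_log r t) * hankel_deriv r t) \<in> borel_measurable lborel"
    by measurable
next
  fix t :: real
  show "(\<lambda>s. exp ((s - 1) * hankel_log r t) * g (hankel_log r t) * hankel_deriv r t) holomorphic_on UNIV"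
    by (intro holomorphic_intros)
qed auto

section \<open>Hankel integrals as integrals over the half-line\<close>

text \<open>Monodromy: one turn about the origin multiplies the power \<open>s - 1\<close> by
  \<open>exp (2 pi i s)\<close>, as the integer 1 in the exponent has no effect.\<close>

lemma exp_mult_two_pi_shift:
  "exp ((s - 1) * (z + 2 * of_real pi * \<i>)) = exp (2 * of_real pi * \<i> * s) * exp ((s - 1) * (z::complex))"
proof -
  have "(s - 1) * (z + 2 * of_real pi * \<i>) = 2 * of_real pi * \<i> * s + (s - 1) * z - 2 * of_real pi * \<i>"
    by (simp add: algebra_simps)
  then show ?thesis by (simp add: exp_add exp_diff)
qed

text \<open>In the coordinate p = log v the integrand is holomorphic on a left half-plane, so it has a
  primitive there. Hence the value does not depend on the radius, and the circle contributes nothing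
  in the limit of radius 0.\<close>
lemma hankel_integral_collapse:
  fixes h :: "complex \<Rightarrow> complex"
  assumes s: "Re s > 1" and r: "0 < r" "r < R"
    and hol: "h holomorphic_on ball 0 R - {0}"
    and bound: "\<And>z. z \<in> ball 0 R - {0} \<Longrightarrow> norm (h z) \<le> B / norm z"
    and int: "integrable lborel (\<lambda>x. indicator {0<..} x *\<^sub>R (exp ((s - 1) * of_real (ln x)) * h (of_real x)))"
  shows "hankel_integral r (\<lambda>p. exp ((s - 1) * p) * h (exp p)) =
    (exp (2 * of_real pi * \<i> * s) - 1) *
    (LINT x|lborel. indicator {0<..} x *\<^sub>R (exp ((s - 1) * of_real (ln x)) * h (of_real x)))"
proof -
  define \<phi> where "\<phi> = (\<lambda>x::real. exp ((s - 1) * of_real (ln x)) * h (of_real x))"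
  define E where "E = exp (2 * of_real pi * \<i> * s)"
  define T where "T = (\<lambda>a::real. LINT x|lborel. indicator {a<..} x *\<^sub>R \<phi> x)"
  \<comment> \<open>With v = exp p one has dv = v dp, so in the coordinate \<open>p\<close> the
    exponent is \<open>s\<close> instead of \<open>s - 1\<close>.\<close>
  define G where "G = (\<lambda>p. exp (s * p) * h (exp p))"
  define H where "H = {p::complex. Re p < ln R}"
  have R: "R > 0" using r by simp
  have H: "open H" "convex H"
    unfolding H_def by (auto simp: open_halfspace_Re_lt convex_halfspace_Re_lt)
  have expH: "exp p \<in> ball 0 R - {0}" if "p \<in> H" for p
    using that R exp_less_mono[of "Re p" "ln R"] by (auto simp: H_def)
  have holG: "G holomorphic_on H"
    unfolding G_def using expH
    by (intro holomorphic_intros holomorphic_on_compose_gen[OF _ hol, unfolded o_def]) auto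
  obtain P where P: "\<And>p. p \<in> H \<Longrightarrow> (P has_field_derivative G p) (at p within H)"
    using holomorphic_convex_primitive'[OF H(2,1) holG] by blast
  then have P: "(P has_field_derivative G p) (at p)" if "p \<in> H" for p
    using that H(1) by (metis at_within_open)
  \<comment> \<open>\<open>Q x\<close> is the integral of \<open>G\<close> over the vertical segment
    from x to x + 2 pi i, that is, the contribution of the circle of radius exp x.\<close>
  define Q where "Q = (\<lambda>x::real. P (of_real x + 2 * of_real pi * \<i>) - P (of_real x))"
  have G_shift: "G (p + 2 * of_real pi * \<i>) = E * G p" for p
    by (simp add: G_def E_def algebra_simps exp_add)
  have G_ln: "G (of_real (ln x)) = of_real x * \<phi> x" if "x > 0" for x
  proof -
    have "exp (s * of_real (ln x)) = exp ((s - 1) * of_real (ln x)) * exp (of_real (ln x))"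
      by (simp add: exp_add[symmetric] algebra_simps)
    then show ?thesis using that by (simp add: G_def \<phi>_def exp_of_real)
  qed
  have intT: "integrable lborel (\<lambda>x. indicator {a<..} x *\<^sub>R \<phi> x)" if "a \<ge> 0" for a
  proof -
    have "integrable lborel (\<lambda>x. indicator {a<..} x *\<^sub>R (indicator {0<..} x *\<^sub>R \<phi> x))"
      using integrable_mult_indicator[OF _ int, of "{a<..}"] unfolding \<phi>_def by simp
    also have "(\<lambda>x. indicator {a<..} x *\<^sub>R (indicator {0<..} x *\<^sub>R \<phi> x)) = (\<lambda>x. indicator {a<..} x *\<^sub>R \<phi> x)"
      using that by (auto simp: indicator_def fun_eq_iff)
    finally show ?thesis .
  qed
  have line: "of_real (ln a) + \<i> * of_real t \<in> H" if "0 < a" "a < R" for a t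
    using that by (simp add: H_def)
  have contG: "continuous_on UNIV (\<lambda>t. G (of_real (ln a) + \<i> * of_real t))" if "0 < a" "a < R" for a
    using line[OF that] by (intro continuous_on_compose2[OF holomorphic_on_imp_continuous_on[OF holG]] continuous_intros) auto
  have circle: "(LINT t|lborel. indicator {0..2*pi} t *\<^sub>R (\<i> * G (of_real (ln a) + \<i> * of_real t))) = Q (ln a)"
    if a: "0 < a" "a < R" for a
  proof -
    have "(LINT t|lborel. indicator {0..2*pi} t *\<^sub>R (\<i> * G (of_real (ln a) + \<i> * of_real t))) =
       P (of_real (ln a) + \<i> * of_real (2*pi)) - P (of_real (ln a) + \<i> * of_real 0)"
    proof (rule integral_FTC_atLeastAtMost)
      fix t :: real
      have "((\<lambda>t. P (of_real (ln a) + \<i> * of_real t)) has_vector_derivative \<i> * G (of_real (ln a) + \<i> * of_real t)) (at t)"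
      proof -
        have "((\<lambda>t. of_real (ln a) + \<i> * of_real t) has_vector_derivative \<i>) (at t)"
          by (auto intro!: derivative_eq_intros)
        from field_vector_diff_chain_at[OF this P[OF line[OF a]]] show ?thesis by (simp add: o_def)
      qed
      then show "((\<lambda>t. P (of_real (ln a) + \<i> * of_real t)) has_vector_derivative \<i> * G (of_real (ln a) + \<i> * of_real t)) (at t within {0..2*pi})"
        by (rule has_vector_derivative_at_within)
    next
      show "continuous_on {0..2*pi} (\<lambda>t. \<i> * G (of_real (ln a) + \<i> * of_real t))"
        by (intro continuous_intros continuous_on_subset[OF contG[OF a]]) auto
    qed simp
    then show ?thesis by (simp add: Q_def mult_ac)
  qed
  have int_circle: "integrable lborel (\<lambda>t. indicator {0..2*pi} t *\<^sub>R (\<i> * G (of_real (ln a) + \<i> * of_real t)))"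
    if "0 < a" "a < R" for a
    by (intro borel_integrable_compact compact_Icc continuous_on_mult_left continuous_on_subset[OF contG[OF that]] subset_UNIV)
  have J: "hankel_integral r (\<lambda>p. exp ((s - 1) * p) * h (exp p)) = (E - 1) * T r + Q (ln r)"
  proof -
    \<comment> \<open>Incoming ray, circle and outgoing ray. The substitutions x = r - t and x = r +
      t - 2 pi turn each ray into \<open>T r\<close>, the first with the sign -1 of the direction of
      travel, the second with the monodromy factor \<open>E\<close>. They are spelled as affine maps
      to fit the change of variables for \<open>lborel\<close>.\<close>
    let ?f1 = "\<lambda>t. indicator {r<..} (r + (-1) * t) *\<^sub>R \<phi> (r + (-1) * t)"
    let ?f2 = "\<lambda>t. indicator {0..2*pi} t *\<^sub>R (\<i> * G (of_real (ln r) + \<i> * of_real t))"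
    let ?f3 = "\<lambda>t. indicator {r<..} ((r - 2*pi) + 1 * t) *\<^sub>R \<phi> ((r - 2*pi) + 1 * t)"
    have 1: "integrable lborel ?f1" "T r = (LINT t|lborel. ?f1 t)"
      unfolding T_def using r lborel_integrable_real_affine[OF intT[of r], of "-1" r]
        lborel_integral_real_affine[of "-1" "\<lambda>x. indicator {r<..} x *\<^sub>R \<phi> x" r] by auto
    have 3: "integrable lborel ?f3" "T r = (LINT t|lborel. ?f3 t)"
      unfolding T_def using r lborel_integrable_real_affine[OF intT[of r], of 1 "r - 2*pi"]
        lborel_integral_real_affine[of 1 "\<lambda>x. indicator {r<..} x *\<^sub>R \<phi> x" "r - 2*pi"] by auto
    have 2: "integrable lborel ?f2"
      by (rule int_circle[OF r])
    have "exp ((s - 1) * hankel_log r t) * h (exp (hankel_log r t)) * hankel_deriv r t =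
       - ?f1 t + ?f2 t + E * ?f3 t" for t
    proof -
      consider "t < 0" | "0 \<le> t" "t \<le> 2*pi" | "t > 2*pi" by linarith
      then show ?thesis
      proof cases
        case 1
        then have "exp (of_real (ln (r - t)) :: complex) = of_real (r - t)"
          using r by (simp only: exp_of_real exp_ln)
        with 1 show ?thesis using r pi_gt_zero
          by (simp add: hankel_log_def hankel_deriv_def \<phi>_def del: pi_gt_zero of_real_diff)
      next
        case 2
        have "exp (of_real (ln r) :: complex) = of_real r" using r by (simp only: exp_of_real exp_ln)
        then have "exp (s * (of_real (ln r) + \<i> * of_real t)) = exp ((s - 1) * (of_real (ln r) + \<i> * of_real t)) * (of_real r * exp (\<i> * of_real t))"
          using r by (simp add: exp_add[symmetric] algebra_simps flip: exp_of_real)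
             (simp add: exp_diff)
        with 2 r show ?thesis by (simp add: hankel_log_def hankel_deriv_def G_def mult_ac)
      next
        case 3
        then have p: "t > 0" "\<not> t < 0" "\<not> t \<le> 2 * pi" using pi_gt_zero by linarith+
        have pos: "r + (t - 2*pi) > 0" "r - 2 * pi + 1 * t = r + (t - 2*pi)" using 3 r by linarith+
        have e: "exp (of_real (ln (r + (t - 2*pi))) :: complex) = of_real (r + (t - 2*pi))"
          using pos by (simp only: exp_of_real exp_ln)
        show ?thesis unfolding pos(2) using 3 p r pos(1) e exp_mult_two_pi_shift[of s "of_real (ln (r + (t - 2*pi)))"]
          by (simp add: hankel_log_def hankel_deriv_def \<phi>_def E_def exp_add mult_ac indicator_def del: of_real_add of_real_diff)
      qed
    qed
    then have "hankel_integral r (\<lambda>p. exp ((s - 1) * p) * h (exp p)) = (LINT t|lborel. - ?f1 t + ?f2 t + E * ?f3 t)"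
      unfolding hankel_integral_def by simp
    also have "\<dots> = - T r + Q (ln r) + E * T r"
    proof (rule has_bochner_integral_integral_eq, intro has_bochner_integral_add has_bochner_integral_minus has_bochner_integral_mult_right)
      show "has_bochner_integral lborel ?f1 (T r)" "has_bochner_integral lborel ?f3 (T r)"
        "has_bochner_integral lborel ?f2 (Q (ln r))"
        unfolding has_bochner_integral_iff using 1 2 3 circle[OF r] by (metis (no_types, lifting))+
    qed
    finally show ?thesis by (simp add: algebra_simps)
  qed
  \<comment> \<open>The radius does not matter: \<open>Q (ln x)\<close> has derivative (G (ln x + 2
    pi i) - G (ln x)) / x, which is \<open>(E - 1) * \<phi> x\<close> by the monodromy of
    \<open>G\<close>, and this balances the change of the ray integrals.\<close>
  have indep: "(E - 1) * T a + Q (ln a) = (E - 1) * T r + Q (ln r)" if a: "0 < a" "a \<le> r" for a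
  proof -
    have diff: "T a - T r = (LINT x|lborel. indicator {a..r} x *\<^sub>R \<phi> x)"
    proof -
      have "T a - T r = (LINT x|lborel. indicator {a<..} x *\<^sub>R \<phi> x - indicator {r<..} x *\<^sub>R \<phi> x)"
        unfolding T_def using intT a by (intro Bochner_Integration.integral_diff[symmetric]) auto
      also have "\<dots> = (LINT x|lborel. indicator {a..r} x *\<^sub>R \<phi> x)"
        using a by (intro integral_discrete_difference[where X="{a}"]) (auto simp: indicator_def)
      finally show ?thesis .
    qed
    have "(LINT x|lborel. indicator {a..r} x *\<^sub>R ((E - 1) * \<phi> x)) = Q (ln r) - Q (ln a)"
    proof (rule integral_FTC_atLeastAtMost[OF a(2)])
      fix x assume "a \<le> x" "x \<le> r"
      then have x: "0 < x" "x < R" using a r by linarith+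
      have "((\<lambda>x. Q (ln x)) has_vector_derivative (E - 1) * \<phi> x) (at x)"
      proof -
        have d: "((\<lambda>x. of_real (ln x) + c) has_vector_derivative of_real (1/x)) (at x)" for c :: complex
          using x by (auto intro!: derivative_eq_intros has_vector_derivative_of_real simp: field_simps has_real_derivative_iff_has_vector_derivative[symmetric])
        have H1: "of_real (ln x) + 2 * of_real pi * \<i> \<in> H" "of_real (ln x) + 0 \<in> H"
          using x by (auto simp: H_def)
        have "((\<lambda>x. Q (ln x)) has_vector_derivative of_real (1/x) * G (of_real (ln x) + 2 * of_real pi * \<i>) - of_real (1/x) * G (of_real (ln x) + 0)) (at x)"
          unfolding Q_def
          using has_vector_derivative_diff[OF field_vector_diff_chain_at[OF d P[OF H1(1)]] field_vector_diff_chain_at[OF d P[OF H1(2)]]]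
          by (simp add: o_def)
        then show ?thesis using x unfolding G_shift by (simp add: G_ln algebra_simps)
      qed
      then show "((\<lambda>x. Q (ln x)) has_vector_derivative (E - 1) * \<phi> x) (at x within {a..r})"
        by (rule has_vector_derivative_at_within)
    next
      have "of_real x \<in> ball 0 R - {0::complex}" if "x \<in> {a..r}" for x
        using that a r by auto
      then show "continuous_on {a..r} (\<lambda>x. (E - 1) * \<phi> x)"
        unfolding \<phi>_def using a
        by (intro continuous_intros continuous_on_compose2[OF holomorphic_on_imp_continuous_on[OF hol]]) auto
    qed
    moreover have "(LINT x|lborel. indicator {a..r} x *\<^sub>R ((E - 1) * \<phi> x)) = (E - 1) * (LINT x|lborel. indicator {a..r} x *\<^sub>R \<phi> x)"
      by (simp add: mult.left_commute flip: integral_mult_right_zero)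
    ultimately have "(E - 1) * (T a - T r) = Q (ln r) - Q (ln a)" using diff by simp
    then show ?thesis by (simp add: algebra_simps)
  qed
  define a where "a = (\<lambda>n::nat. r / real (Suc n))"
  have a: "0 < a n" "a n \<le> r" "a n < R" for n
  proof -
    show "0 < a n" "a n \<le> r" using r by (auto simp: a_def field_simps)
    then show "a n < R" using r by linarith
  qed
  have a0: "a \<longlonglongrightarrow> 0"
    unfolding a_def by (rule LIMSEQ_Suc, rule lim_const_over_n)
  have limT: "(\<lambda>n. T (a n)) \<longlonglongrightarrow> T 0"
    unfolding T_def
  proof (rule integral_dominated_convergence[where w = "\<lambda>x. norm (indicator {0<..} x *\<^sub>R \<phi> x)"])
    show "AE x in lborel. (\<lambda>n. indicator {a n<..} x *\<^sub>R \<phi> x) \<longlonglongrightarrow> indicator {0<..} x *\<^sub>R \<phi> x"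
    proof (rule AE_I2, goal_cases)
      case (1 x)
      have "eventually (\<lambda>n. indicator {a n<..} x *\<^sub>R \<phi> x = indicator {0<..} x *\<^sub>R \<phi> x) sequentially"
      proof (cases "x > 0")
        case True
        then have "eventually (\<lambda>n. a n < x) sequentially" using order_tendstoD(2)[OF a0] by auto
        then show ?thesis by eventually_elim (use True in auto)
      next
        case False
        then have "\<not> a n < x" for n using a(1)[of n] by linarith
        with False show ?thesis by auto
      qed
      then show ?case by (rule tendsto_eventually)
    qed
    show "AE x in lborel. norm (indicator {a n<..} x *\<^sub>R \<phi> x) \<le> norm (indicator {0<..} x *\<^sub>R \<phi> x)" for n
      using a(1)[of n] by (auto simp: indicator_def)
    show "(\<lambda>x. indicator {a n<..} x *\<^sub>R \<phi> x) \<in> borel_measurable lborel" for n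
      using a(1)[of n] by (intro borel_measurable_integrable intT) simp
    show "(\<lambda>x. indicator {0<..} x *\<^sub>R \<phi> x) \<in> borel_measurable lborel"
      by (intro borel_measurable_integrable intT) simp
    show "integrable lborel (\<lambda>x. norm (indicator {0<..} x *\<^sub>R \<phi> x))"
      by (intro integrable_norm intT) simp
  qed
  have limQ: "(\<lambda>n. Q (ln (a n))) \<longlonglongrightarrow> 0"
  proof (rule Lim_null_comparison)
    \<comment> \<open>The circle of radius x contributes x to the power Re s from \<open>G\<close>
      and \<open>B / x\<close> from \<open>h\<close>. Since Re s > 1, the remaining power of x is
      positive and the bound tends to 0.\<close>
    define K where "K = (\<lambda>x::real. exp (2*pi*\<bar>Im s\<bar>) * B * x powr (Re s - 1))"
    have Gb: "norm (G (of_real (ln x) + \<i> * of_real t)) \<le> K x" if x: "0 < x" "x < R" and t: "t \<in> {0..2*pi}" for x t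
    proof -
      have e: "norm (exp (of_real (ln x) + \<i> * of_real t)) = x" using x by simp
      have "norm (h (exp (of_real (ln x) + \<i> * of_real t))) \<le> B / x"
        using bound[OF expH[OF line[OF x]], of t] unfolding e .
      moreover have "norm (exp (s * (of_real (ln x) + \<i> * of_real t))) \<le> exp (2*pi*\<bar>Im s\<bar>) * x powr Re s"
      proof -
        have "- (Im s * t) \<le> \<bar>Im s\<bar> * t" using t by (metis abs_ge_minus_self abs_mult abs_of_nonneg atLeastAtMost_iff)
        also have "\<dots> \<le> \<bar>Im s\<bar> * (2*pi)" using t by (intro mult_left_mono) auto
        finally show ?thesis using x by (simp add: powr_def exp_add[symmetric] mult_ac)
      qed
      ultimately have "norm (G (of_real (ln x) + \<i> * of_real t)) \<le> (exp (2*pi*\<bar>Im s\<bar>) * x powr Re s) * (B / x)"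
        unfolding G_def norm_mult by (intro mult_mono) auto
      also have "\<dots> = K x" using x by (simp add: K_def powr_diff)
      finally show ?thesis .
    qed
    show "eventually (\<lambda>n. norm (Q (ln (a n))) \<le> 2*pi * K (a n)) sequentially"
    proof (intro always_eventually allI)
      fix n
      have K0: "0 \<le> K (a n)" using order_trans[OF norm_ge_zero Gb[OF a(1,3)[of n], of 0]] by simp
      have "norm (Q (ln (a n))) \<le> (LINT t|lborel. indicator {0..2*pi} t *\<^sub>R K (a n))"
        unfolding circle[OF a(1,3), symmetric]
      proof (rule Bochner_Integration.integral_norm_bound_integral)
        show "integrable lborel (\<lambda>t. indicator {0..2*pi} t *\<^sub>R (\<i> * G (of_real (ln (a n)) + \<i> * of_real t)))"
          by (rule int_circle[OF a(1,3)])
        show "integrable lborel (\<lambda>t. indicator {0..2*pi} t *\<^sub>R K (a n))"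
          by (intro integrable_scaleR_left) auto
      qed (use Gb[OF a(1,3)] in \<open>auto simp: indicator_def norm_mult\<close>)
      also have "\<dots> = 2*pi * K (a n)" by simp
      finally show "norm (Q (ln (a n))) \<le> 2*pi * K (a n)" .
    qed
    have "(\<lambda>n. a n powr (Re s - 1)) \<longlonglongrightarrow> 0 powr (Re s - 1)"
      using s a(1) by (intro tendsto_powr' a0 tendsto_const) (auto intro!: always_eventually less_imp_le)
    then show "(\<lambda>n. 2*pi * K (a n)) \<longlonglongrightarrow> 0"
      unfolding K_def using s by (intro tendsto_mult_right_zero) auto
  qed
  have "(\<lambda>n. (E - 1) * T (a n) + Q (ln (a n))) \<longlonglongrightarrow> (E - 1) * T 0 + 0"
    by (intro tendsto_intros limT limQ)
  moreover have "(\<lambda>n. (E - 1) * T (a n) + Q (ln (a n))) = (\<lambda>n. (E - 1) * T r + Q (ln r))"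
    using indep[OF a(1,2)] by simp
  ultimately have "(E - 1) * T r + Q (ln r) = (E - 1) * T 0"
    by (simp add: LIMSEQ_const_iff)
  then show ?thesis using J by (simp add: E_def T_def \<phi>_def)
qed

section \<open>Hankel's formula for the reciprocal gamma function\<close>

lemma Gamma_lborel:
  assumes "Re s > 0" "a > (0::real)"
  shows "has_bochner_integral lborel
    (\<lambda>x. indicator {0<..} x *\<^sub>R (exp ((s - 1) * of_real (ln x)) * exp (- (of_real a * of_real x))))
    (exp (- s * of_real (ln a)) * Gamma s)"
proof -
  define f where "f = (\<lambda>x::real. indicator {0<..} x *\<^sub>R (exp ((s - 1) * of_real (ln x)) * exp (- (of_real x :: complex))))"
  have f_eq: "f = (\<lambda>x. indicator {0<..} x *\<^sub>R (complex_of_real x powr (s - 1) / of_real (exp (1 * x))))"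
    by (auto simp: f_def indicator_def powr_def Ln_of_real exp_minus divide_inverse exp_of_real fun_eq_iff)
  have [measurable]: "f \<in> borel_measurable borel" unfolding f_def by measurable
  have "integrable lebesgue f"
    using absolutely_integrable_Gamma_integral[OF assms(1), of 1] unfolding f_eq set_integrable_def by simp
  then have int: "integrable lborel f" by (subst (asm) integrable_completion) auto
  have "((\<lambda>t. of_real t powr (s - 1) / of_real (exp t)) has_integral Gamma s) {0<..}"
  proof (subst has_integral_spike_set_eq[where T = "{0..}"])
    show "negligible {t \<in> {0..} - {0<..}. of_real t powr (s - 1) / of_real (exp t) \<noteq> (0::complex)}"
      by (rule negligible_subset[of "{0}"]) auto
    show "negligible {t \<in> {0<..} - {0..}. of_real t powr (s - 1) / of_real (exp t) \<noteq> (0::complex)}"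
      by (rule negligible_subset[of "{}"]) auto
  qed (rule Gamma_integral_complex[OF assms(1)])
  then have "(f has_integral Gamma s) UNIV"
    unfolding f_eq has_integral_restrict_UNIV[symmetric, of _ _ "{0<..}"]
    by (rule has_integral_eq[rotated]) (auto simp: indicator_def)
  then have eq: "(LINT x|lborel. f x) = Gamma s"
    using has_integral_integral_lborel[OF int] has_integral_unique by blast
  \<comment> \<open>The substitution of a x for x reduces everything to a = 1: the power contributes
    the exponent -(s - 1) of a and the measure a factor 1/a, together the exponent -s.\<close>
  define g where "g = (\<lambda>x::real. indicator {0<..} x *\<^sub>R (exp ((s - 1) * of_real (ln x)) * exp (- (of_real a * of_real x :: complex))))"
  have g: "g x = exp (- ((s - 1) * of_real (ln a))) * f (0 + a * x)" for x
  proof (cases "x > 0")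
    case True
    then have "(s - 1) * of_real (ln (a * x)) = (s - 1) * of_real (ln a) + (s - 1) * of_real (ln x)"
      using assms by (simp add: ln_mult algebra_simps)
    then show ?thesis using True assms
      by (simp add: g_def f_def exp_minus exp_add)
  qed (use assms in \<open>auto simp: g_def f_def indicator_def zero_less_mult_iff\<close>)
  have "integrable lborel (\<lambda>x. f (0 + a * x))"
    using assms by (intro lborel_integrable_real_affine[OF int]) auto
  moreover have "Gamma s = a *\<^sub>R (LINT x|lborel. f (0 + a * x))"
    using lborel_integral_real_affine[of a f 0] assms eq by simp
  ultimately have "has_bochner_integral lborel (\<lambda>x. f (0 + a * x)) (Gamma s / of_real a)"
    using assms by (simp add: has_bochner_integral_iff scaleR_conv_of_real)
  then have "has_bochner_integral lborel g (exp (- ((s - 1) * of_real (ln a))) * (Gamma s / of_real a))"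
    unfolding g by (rule has_bochner_integral_mult_right)
  moreover have "exp (- ((s - 1) * of_real (ln a))) = exp (- s * of_real (ln a)) * of_real a"
  proof -
    have "- ((s - 1) * of_real (ln a)) = - s * of_real (ln a) + of_real (ln a)" by (simp add: algebra_simps)
    then show ?thesis using assms by (simp only: exp_add exp_of_real exp_ln)
  qed
  ultimately show ?thesis unfolding g_def using assms by simp
qed

text \<open>The first factor is 2 i exp (i pi s) sin (pi s), and the reflection formula rewrites
  \<open>Gamma s\<close> times the sine as pi times \<open>rGamma (1 - s)\<close>. This trades the
  collapsed form, available on a half-plane, for an expression entire in \<open>s\<close>.\<close>

lemma exp_minus_one_mult_Gamma:
  assumes "Re s > 0"
  shows "(exp (2 * of_real pi * \<i> * s) - 1) * Gamma s = 2 * of_real pi * \<i> * exp (\<i> * of_real pi * s) * rGamma (1 - s)"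
proof -
  have "s \<notin> \<int>\<^sub>\<le>\<^sub>0" using assms by (auto elim!: nonpos_Ints_cases)
  then have G: "Gamma s * rGamma s = 1" by (simp add: rGamma_inverse_Gamma Gamma_eq_zero_iff)
  have "rGamma (1 - s) = Gamma s * (rGamma s * rGamma (1 - s))" using G by (simp flip: mult.assoc)
  also have "\<dots> = Gamma s * sin (of_real pi * s) / of_real pi" by (simp add: rGamma_reflection_complex)
  finally have r: "of_real pi * rGamma (1 - s) = Gamma s * sin (of_real pi * s)" by simp
  have e: "exp (2 * of_real pi * \<i> * s) - 1 = 2 * \<i> * exp (\<i> * of_real pi * s) * sin (of_real pi * s)"
    by (simp add: sin_exp_eq field_simps exp_minus flip: exp_add)
  show ?thesis unfolding e using r by (simp add: mult_ac)
qed

text \<open>On the rays the variable is real and positive, and nothing is lost. On the circle both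
  Re (a v) and r Re a have modulus at most r |a|, whence the 2 in the first factor.\<close>

lemma norm_exp_mult_exp_hankel_log:
  assumes "r > 0"
  shows "norm (exp (- (a * exp (hankel_log r t)))) \<le> exp (2 * norm a * r) * exp (- Re a * exp (Re (hankel_log r t)))"
proof -
  have "Re (a * exp (hankel_log r t)) \<ge> Re a * exp (Re (hankel_log r t)) - 2 * norm a * r"
  proof (cases "0 \<le> t \<and> t \<le> 2*pi")
    case True
    then have e: "exp (Re (hankel_log r t)) = r" using assms exp_Re_hankel_log[of r t] by auto
    have "\<bar>Re (a * exp (hankel_log r t))\<bar> \<le> norm (a * exp (hankel_log r t))" by (rule abs_Re_le_cmod)
    also have "\<dots> = norm a * r" using e by (simp add: norm_mult)
    finally have 1: "\<bar>Re (a * exp (hankel_log r t))\<bar> \<le> norm a * r" .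
    have "Re a * r \<le> norm a * r" using assms complex_Re_le_cmod by (intro mult_right_mono) auto
    with 1 e show ?thesis by simp
  next
    case False
    then have "exp (hankel_log r t) = of_real (exp (Re (hankel_log r t)))"
      using assms pi_gt_zero by (auto simp: hankel_log_def exp_add exp_of_real simp del: pi_gt_zero)
    then have "Re (a * exp (hankel_log r t)) = Re a * exp (Re (hankel_log r t))" by simp
    then show ?thesis using assms by simp
  qed
  then show ?thesis by (simp add: exp_add[symmetric])
qed

lemma one_islimpt_pos_reals: "1 islimpt (complex_of_real ` {0<..})"
  unfolding islimpt_approachable
proof (intro allI impI)
  fix e :: real assume "e > 0"
  moreover have "complex_of_real (1 + e/2) - 1 = of_real (e/2)" by simp
  ultimately show "\<exists>x'\<in>complex_of_real ` {0<..}. x' \<noteq> 1 \<and> dist x' 1 < e"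
    by (intro bexI[of _ "complex_of_real (1 + e/2)"])
       (auto simp: dist_norm simp del: of_real_add of_real_divide)
qed

text \<open>The collapse gives the formula for positive real \<open>a\<close> and Re s > 1. It is
  continued first in \<open>s\<close> with \<open>a\<close> fixed, then in \<open>a\<close> from the
  positive reals, which accumulate at 1, to the right half-plane. Complex \<open>a\<close> is
  required because the \<open>w\<close>-integral uses a = k + lam.\<close>

lemma hankel_integral_Gamma:
  assumes r: "r > 0" and a: "Re a > 0"
  shows "hankel_integral r (\<lambda>p. exp ((s - 1) * p) * exp (- (a * exp p))) =
    2 * of_real pi * \<i> * exp (\<i> * of_real pi * s) * rGamma (1 - s) * exp (- s * Ln a)"
proof -
  let ?J = "\<lambda>a s. hankel_integral r (\<lambda>p. exp ((s - 1) * p) * exp (- (a * exp p)))"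
  let ?C = "\<lambda>s. 2 * of_real pi * \<i> * exp (\<i> * of_real pi * s) * rGamma (1 - s)"
  have 1: "?J (of_real x) s = ?C s * exp (- s * of_real (ln x))" if x: "x > 0" and s: "Re s > 1" for x s
  proof -
    note G = Gamma_lborel[of s x, unfolded has_bochner_integral_iff]
    have "?J (of_real x) s = (exp (2 * of_real pi * \<i> * s) - 1) * (exp (- s * of_real (ln x)) * Gamma s)"
    \<comment> \<open>There is no pole here, so any disc larger than the contour serves; the factor
      \<open>2*r\<close> in \<open>B\<close> only brings a bounded function into the form
      \<open>B / norm z\<close>.\<close>
    proof (subst hankel_integral_collapse[where R = "2 * r" and B = "exp (x * (2*r)) * (2*r)"])
      fix z :: complex assume z: "z \<in> ball 0 (2 * r) - {0}"
      have "norm (exp (- (of_real x * z))) \<le> exp (norm (- (of_real x * z)))" by (rule norm_exp)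
      also have "\<dots> \<le> exp (x * (2*r))" using z x by (simp add: norm_mult)
      also have "\<dots> \<le> exp (x * (2*r)) * (2*r) / norm z" using z r by (simp add: field_simps)
      finally show "norm (exp (- (of_real x * z))) \<le> exp (x * (2*r)) * (2*r) / norm z" .
    next
      show "(\<lambda>z. exp (- (of_real x * z))) holomorphic_on ball 0 (2 * r) - {0}"
        by (intro holomorphic_intros)
    qed (use r x s G in auto)
    then show ?thesis using exp_minus_one_mult_Gamma[of s] s by (simp add: mult_ac)
  qed
  have bd: "norm (exp (- (a * exp (hankel_log r t)))) \<le> exp (2 * norm a * r) * exp (- Re a * exp (Re (hankel_log r t)))" for a t
    by (rule norm_exp_mult_exp_hankel_log[OF r])
  have 2: "?J (of_real x) s = ?C s * exp (- s * of_real (ln x))" if x: "x > 0" for x s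
  proof (rule analytic_continuation_open[where s = "{s. Re s > 1}" and s' = UNIV
      and f = "?J (of_real x)" and g = "\<lambda>s. ?C s * exp (- s * of_real (ln x))"])
    show "{s. Re s > 1} \<noteq> {}" by (auto intro!: exI[of _ 2])
    show "?J (of_real x) holomorphic_on UNIV"
      using hankel_integral_holomorphic[OF r x, of "\<lambda>p. exp (- (of_real x * exp p))" "exp (2 * norm (of_real x :: complex) * r)"] bd[of "of_real x"]
      by simp
    show "(\<lambda>s. ?C s * exp (- s * of_real (ln x))) holomorphic_on UNIV"
      by (intro holomorphic_intros)
  qed (use 1 x open_halfspace_Re_gt in auto)
  have "?J a s - ?C s * exp (- s * Ln a) = 0"
  proof (rule analytic_continuation[where f = "\<lambda>a. ?J a s - ?C s * exp (- s * Ln a)" and S = "{a. Re a > 0}" and U = "complex_of_real ` {0<..}" and \<xi> = 1])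
    have 1: "(\<lambda>a. ?J a s) holomorphic_on {a. Re a > 0}"
      unfolding hankel_integral_def
    proof (rule holomorphic_on_integral)
      fix a0 :: complex assume a0: "a0 \<in> {a. Re a > 0}"
      \<comment> \<open>Within distance \<open>c\<close> of \<open>a0\<close> the real part stays at
        least \<open>c\<close>. Half of this decay is spent on the power of the variable, the other
        half gives integrability.\<close>
      define c where "c = Re a0 / 2"
      have c: "c > 0" using a0 by (simp add: c_def)
      obtain C where C: "C > 0" "\<And>(s'::complex) t. norm s' \<le> norm (s - 1) \<Longrightarrow> norm (exp (s' * hankel_log r t)) \<le> C * exp (c/2 * exp (Re (hankel_log r t)))"
        using exp_mult_hankel_log_growth[of r "c/2" "norm (s - 1)"] r c by auto
      define D where "D = C * exp (2 * (norm a0 + c) * r) * (1 + r)"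
      show "\<exists>d>0. \<exists>g. integrable lborel g \<and> (\<forall>z\<in>ball a0 d \<inter> {a. 0 < Re a}. \<forall>t\<in>space lborel.
           norm (exp ((s - 1) * hankel_log r t) * exp (- (z * exp (hankel_log r t))) * hankel_deriv r t) \<le> g t)"
      proof (intro exI[of _ c] conjI exI[of _ "\<lambda>t. D * exp (- (c/2) * exp (Re (hankel_log r t)))"] ballI)
        show "integrable lborel (\<lambda>t. D * exp (- (c/2) * exp (Re (hankel_log r t))))"
          using c r by (intro integrable_exp_neg_hankel) auto
        fix z t assume "z \<in> ball a0 c \<inter> {a. 0 < Re a}"
        then have d: "norm (z - a0) < c" by (simp add: dist_norm norm_minus_commute)
        have n: "norm z \<le> norm a0 + c" using d norm_triangle_ineq[of a0 "z - a0"] by auto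
        have re: "Re z \<ge> c" using d abs_Re_le_cmod[of "z - a0"] unfolding c_def minus_complex.sel by linarith
        let ?e = "exp (Re (hankel_log r t))"
        have "exp (2 * norm z * r) * exp (- Re z * ?e) \<le> exp (2 * (norm a0 + c) * r) * exp (- c * ?e)"
          using n re r by (intro mult_mono) auto
        then have "norm (exp (- (z * exp (hankel_log r t)))) \<le> exp (2 * (norm a0 + c) * r) * exp (- c * ?e)"
          using bd[of z t] by linarith
        then have "norm (exp ((s - 1) * hankel_log r t) * exp (- (z * exp (hankel_log r t))) * hankel_deriv r t)
          \<le> (C * exp (c/2 * ?e)) * (exp (2 * (norm a0 + c) * r) * exp (- c * ?e)) * (1 + r)"
          unfolding norm_mult using C(1) r by (intro mult_mono C(2) norm_hankel_deriv_le) auto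
        also have "\<dots> = D * (exp (c/2 * ?e) * exp (- c * ?e))" by (simp add: D_def mult_ac)
        also have "exp (c/2 * ?e) * exp (- c * ?e) = exp (- (c/2) * ?e)"
          by (simp add: exp_add[symmetric])
        finally show "norm (exp ((s - 1) * hankel_log r t) * exp (- (z * exp (hankel_log r t))) * hankel_deriv r t)
          \<le> D * exp (- (c/2) * ?e)" .
      qed (use c in auto)
    next
      fix t :: real
      show "(\<lambda>z. exp ((s - 1) * hankel_log r t) * exp (- (z * exp (hankel_log r t))) * hankel_deriv r t) holomorphic_on {a. 0 < Re a}"
        by (intro holomorphic_intros)
    qed (auto simp: open_halfspace_Re_gt)
    have 2: "(\<lambda>a. exp (- s * Ln a)) holomorphic_on {a. Re a > 0}"
      by (intro holomorphic_intros) (auto elim!: nonpos_Reals_cases)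
    show "(\<lambda>a. ?J a s - ?C s * exp (- s * Ln a)) holomorphic_on {a. Re a > 0}"
      by (intro holomorphic_on_diff 1 holomorphic_on_mult[OF holomorphic_on_const 2])
  qed (use a 2 one_islimpt_pos_reals in \<open>auto simp: open_halfspace_Re_gt convex_connected convex_halfspace_Re_gt Ln_of_real\<close>)
  then show ?thesis by simp
qed

section \<open>The zeta function\<close>

text \<open>For Re z > 0 this is the sum of exp (- n z) over n >= 2; the absent term n = 1 is the
  reason for the -1 in zeta s - 1. The pole at 0 is simple.\<close>

definition zeta_kernel :: "complex \<Rightarrow> complex" where
  "zeta_kernel z = exp (- z) / (exp z - 1)"

lemma exp_quarter_le: "exp (1/4::real) \<le> 4/3"
proof -
  have "3/4 \<le> exp (- (1/4::real))" using exp_ge_add_one_self[of "- (1/4::real)"] by simp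
  then show ?thesis by (simp add: exp_minus field_simps)
qed

text \<open>The Taylor remainder after the linear term is at most 4/3 * 1/4 * |z|, a third of |z|.
  Hence 0 is a simple zero and the only one in this disc, which is one reason for taking radii below
  1/4.\<close>

lemma norm_exp_minus_one_ge:
  fixes z :: complex
  assumes "norm z \<le> 1/4"
  shows "norm (exp z - 1) \<ge> 2/3 * norm z"
proof -
  have "norm (exp z - (\<Sum>i\<le>1. z ^ i / fact i)) \<le> exp \<bar>Re z\<bar> * norm z ^ Suc 1 / fact 1"
    by (rule Taylor_exp)
  then have 1: "norm (exp z - 1 - z) \<le> exp \<bar>Re z\<bar> * norm z * norm z"
    by (simp add: power2_eq_square diff_diff_eq)
  have "exp \<bar>Re z\<bar> \<le> exp (1/4)" using assms abs_Re_le_cmod[of z] by simp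
  also note exp_quarter_le
  finally have "exp \<bar>Re z\<bar> * norm z \<le> 4/3 * (1/4)" using assms by (intro mult_mono) auto
  then have "exp \<bar>Re z\<bar> * norm z * norm z \<le> 1/3 * norm z" by (intro mult_right_mono) auto
  with 1 have "norm (exp z - 1 - z) \<le> 1/3 * norm z" by linarith
  moreover have "norm z \<le> norm (exp z - 1) + norm (exp z - 1 - z)"
    using norm_triangle_ineq4[of "exp z - 1" "exp z - 1 - z"] by simp
  ultimately show ?thesis by simp
qed

text \<open>The rate 2 is that of the leading exponential: on the rays the kernel is exp (- 2
  \<rho>) / (1 - exp (- \<rho>)), and the denominator is bounded below because \<rho> >= r.\<close>

lemma zeta_kernel_hankel_bound:
  assumes "0 < r" "r < 1/4"
  obtains C where "C > 0"
    "\<And>t. norm (zeta_kernel (exp (hankel_log r t))) \<le> C * exp (- 2 * exp (Re (hankel_log r t)))"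
proof -
  \<comment> \<open>The first summand serves the circle, where exp r is rewritten as exp (3 r) exp
    (- 2 r); the second serves the rays.\<close>
  define C where "C = 2 / r * exp (3 * r) + 1 / (1 - exp (- r))"
  have r1: "exp (- r) < 1" using assms by simp
  have C: "C \<ge> 2 / r * exp (3 * r)" "C \<ge> 1 / (1 - exp (- r))" "C > 0"
    using r1 assms unfolding C_def by (auto intro!: add_pos_pos)
  show ?thesis
  proof (rule that[OF C(3)])
    fix t
    let ?v = "exp (hankel_log r t)" and ?\<rho> = "exp (Re (hankel_log r t))"
    show "norm (zeta_kernel ?v) \<le> C * exp (- 2 * ?\<rho>)"
    proof (cases "0 \<le> t \<and> t \<le> 2*pi")
      case True
      then have \<rho>: "?\<rho> = r" using assms exp_Re_hankel_log[of r t] by auto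
      then have nv: "norm ?v = r" by simp
      have 1: "norm (exp ?v - 1) \<ge> 2/3 * r" using norm_exp_minus_one_ge[of ?v] nv assms by simp
      have "norm (exp (- ?v)) \<le> exp (norm (- ?v))" by (rule norm_exp)
      then have "norm (zeta_kernel ?v) \<le> exp r / (2/3 * r)"
        unfolding zeta_kernel_def norm_divide using 1 nv assms by (intro frac_le) auto
      also have "\<dots> \<le> 2 / r * exp r" using assms by (simp add: field_simps)
      also have "\<dots> = 2 / r * exp (3 * r) * exp (- 2 * ?\<rho>)" unfolding \<rho> by (simp add: exp_add[symmetric])
      also have "\<dots> \<le> C * exp (- 2 * ?\<rho>)" using C by (intro mult_right_mono) auto
      finally show ?thesis .
    next
      case False
      then have v: "?v = of_real ?\<rho>"
        using assms pi_gt_zero by (auto simp: hankel_log_def exp_add exp_of_real simp del: pi_gt_zero)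
      have \<rho>: "?\<rho> \<ge> r" using exp_Re_hankel_log_ge(1)[OF assms(1)] .
      have "zeta_kernel ?v = of_real (exp (- ?\<rho>) / (exp ?\<rho> - 1))"
        unfolding zeta_kernel_def v by (simp add: exp_of_real[symmetric])
      also have "exp (- ?\<rho>) / (exp ?\<rho> - 1) = exp (- 2 * ?\<rho>) / (1 - exp (- ?\<rho>))"
      proof -
        have "exp ?\<rho> - 1 = exp ?\<rho> * (1 - exp (- ?\<rho>))" by (simp add: algebra_simps exp_minus)
        then show ?thesis by (simp add: exp_minus field_simps flip: exp_add)
      qed
      finally have "norm (zeta_kernel ?v) = \<bar>exp (- 2 * ?\<rho>) / (1 - exp (- ?\<rho>))\<bar>"
        by (simp only: norm_of_real)
      then have "norm (zeta_kernel ?v) = exp (- 2 * ?\<rho>) / (1 - exp (- ?\<rho>))" by simp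
      also have "\<dots> \<le> exp (- 2 * ?\<rho>) / (1 - exp (- r))" using r1 \<rho> by (intro divide_left_mono) auto
      also have "\<dots> = 1 / (1 - exp (- r)) * exp (- 2 * ?\<rho>)" by simp
      also have "\<dots> \<le> C * exp (- 2 * ?\<rho>)" using C by (intro mult_right_mono) auto
      finally show ?thesis .
    qed
  qed
qed

lemma zeta_kernel_measurable [measurable]: "zeta_kernel \<in> borel_measurable borel"
  unfolding zeta_kernel_def by measurable

lemma hankel_zeta_holomorphic:
  assumes "0 < r" "r < 1/4"
  shows "(\<lambda>s. hankel_integral r (\<lambda>p. exp ((s - 1) * p) * zeta_kernel (exp p))) holomorphic_on UNIV"
proof -
  obtain C where C: "C > 0"
    "\<And>t. norm (zeta_kernel (exp (hankel_log r t))) \<le> C * exp (- 2 * exp (Re (hankel_log r t)))"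
    using zeta_kernel_hankel_bound[OF assms] by blast
  show ?thesis
  proof (rule hankel_integral_holomorphic[where g = "\<lambda>p. zeta_kernel (exp p)" and c = 2 and K = C])
    show "(\<lambda>t. zeta_kernel (exp (hankel_log r t))) \<in> borel_measurable borel" by measurable
  qed (use assms(1) C(2) in simp_all)
qed

lemma summable_dirichlet:
  assumes "\<sigma> > (1::real)"
  shows "summable (\<lambda>n. real (Suc n) powr (- \<sigma>))"
  using assms summable_real_powr_iff[of "- \<sigma>"] by (subst summable_Suc_iff) auto

lemma norm_dirichlet_term: "norm (1 / of_nat (Suc n) powr s) = real (Suc n) powr (- Re s)"
  using norm_powr_real_powr[of "of_nat (Suc n)" s] by (simp add: norm_divide norm_inverse powr_minus divide_inverse del: of_nat_Suc)

lemma Mellin_zeta_kernel: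
  assumes "Re s > 1"
  shows "has_bochner_integral lborel
    (\<lambda>x. indicator {0<..} x *\<^sub>R (exp ((s - 1) * of_real (ln x)) * zeta_kernel (of_real x)))
    (Gamma s * ((\<Sum>n. 1 / of_nat (Suc n) powr s) - 1))"
proof -
  define f where "f = (\<lambda>(k::nat) (x::real). indicator {0<..} x *\<^sub>R
    (exp ((s - 1) * of_real (ln x)) * exp (- (of_real (real k + 2) * of_real x :: complex))))"
  \<comment> \<open>The absolute value of the integrand of \<open>Gamma (s - 1)\<close>: summing the
    geometric series costs a factor 1/x near 0, which lowers the exponent by one and is affordable
    because Re s > 1.\<close>
  define w where "w = (\<lambda>x::real. norm (indicator {0<..} x *\<^sub>R
    (exp ((s - 1 - 1) * of_real (ln x)) * exp (- (of_real 1 * of_real x :: complex)))))"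
  have G: "has_bochner_integral lborel (f k) (exp (- s * of_real (ln (real k + 2))) * Gamma s)" for k
    unfolding f_def using assms by (intro Gamma_lborel) auto
  have w: "integrable lborel w"
    unfolding w_def using Gamma_lborel[of "s - 1" 1] assms by (intro integrable_norm) (auto simp: has_bochner_integral_iff)
  have bd: "(\<Sum>k<n. norm (f k x)) \<le> w x" for n x
  proof (cases "x > 0")
    case True
    let ?q = "exp (- x)"
    have q: "?q < 1" using True by simp
    have "(\<Sum>k<n. norm (f k x)) = exp ((Re s - 1) * ln x) * ?q\<^sup>2 * (\<Sum>k<n. ?q ^ k)"
      unfolding sum_distrib_left
    proof (rule sum.cong)
      fix k
      have "exp (- ((real k + 2) * x)) = ?q\<^sup>2 * ?q ^ k"
        by (simp add: exp_of_nat_mult[symmetric] exp_double[symmetric] exp_add[symmetric] algebra_simps)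
      then show "norm (f k x) = exp ((Re s - 1) * ln x) * ?q\<^sup>2 * ?q ^ k"
        using True by (simp add: f_def norm_mult)
    qed simp
    also have "\<dots> \<le> exp ((Re s - 1) * ln x) * ?q\<^sup>2 * (1 / (1 - ?q))"
    proof (intro mult_left_mono)
      have "(\<Sum>k<n. ?q ^ k) \<le> (\<Sum>k. ?q ^ k)" using q by (intro sum_le_suminf summable_geometric) auto
      then show "(\<Sum>k<n. ?q ^ k) \<le> 1 / (1 - ?q)" using q by (simp add: suminf_geometric)
    qed auto
    \<comment> \<open>From 1 + x <= exp x one gets 1 - exp (- x) >= x exp (- x). One of the two
      factors exp (- x) is thereby cancelled, the other remains for decay at infinity.\<close>
    also have "\<dots> \<le> exp ((Re s - 1) * ln x) * ?q\<^sup>2 * (1 / (x * ?q))"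
    proof (intro mult_left_mono divide_left_mono)
      have "(1 + x) * ?q \<le> exp x * ?q" by (intro mult_right_mono exp_ge_add_one_self) auto
      then show "x * ?q \<le> 1 - ?q" by (simp add: exp_minus algebra_simps)
    qed (use True q in auto)
    also have "\<dots> = exp ((Re s - 1) * ln x) / x * ?q" using True by (simp add: power2_eq_square)
    also have "exp ((Re s - 1) * ln x) / x = exp ((Re s - 1 - 1) * ln x)"
    proof -
      have "(Re s - 1 - 1) * ln x = (Re s - 1) * ln x - ln x" by (simp add: algebra_simps)
      then show ?thesis using True by (simp only: exp_diff exp_ln)
    qed
    finally show ?thesis using True by (simp add: w_def norm_mult)
  qed (auto simp: f_def w_def)
  have meas: "f k \<in> borel_measurable lborel" for k
    unfolding f_def by measurable
  note ds = dominated_series[OF meas w bd]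
  have sum_f: "(\<Sum>k. f k x) = indicator {0<..} x *\<^sub>R (exp ((s - 1) * of_real (ln x)) * zeta_kernel (of_real x))" for x
  proof (cases "x > 0")
    case True
    let ?q = "exp (- (of_real x :: complex))"
    have q: "norm ?q < 1" using True by simp
    have e1: "exp (complex_of_real x) \<noteq> 1" using True by (metis exp_of_real of_real_eq_1_iff exp_eq_one_iff less_irrefl)
    have "f k x = exp ((s - 1) * of_real (ln x)) * ?q\<^sup>2 * ?q ^ k" for k
      using True by (simp add: f_def exp_of_nat_mult[symmetric] exp_double[symmetric] exp_add[symmetric] algebra_simps)
    then have 1: "(\<Sum>k. f k x) = exp ((s - 1) * of_real (ln x)) * ?q\<^sup>2 * (1 / (1 - ?q))"
      using q by (simp add: suminf_mult summable_geometric suminf_geometric)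
    have 2: "?q\<^sup>2 * (1 / (1 - ?q)) = zeta_kernel (of_real x)"
      using e1 by (simp add: zeta_kernel_def exp_minus field_simps power2_eq_square)
    show ?thesis using True unfolding 1 mult.assoc 2 by simp
  qed (auto simp: f_def)
  have "(\<lambda>k. integral\<^sup>L lborel (f k)) = (\<lambda>k. Gamma s * (1 / of_nat (Suc (Suc k)) powr s))"
  proof
    fix k
    have "exp (- s * of_real (ln (real k + 2))) = 1 / of_nat (Suc (Suc k)) powr s"
    proof -
      have n: "of_nat (Suc (Suc k)) = complex_of_real (real k + 2)" by simp
      have "Ln (complex_of_real (real k + 2)) = of_real (ln (real k + 2))"
        by (rule Ln_of_real) simp
      moreover have "complex_of_real (real k + 2) \<noteq> 0" by (subst of_real_eq_0_iff) simp
      ultimately have "of_nat (Suc (Suc k)) powr s = exp (s * of_real (ln (real k + 2)))"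
        unfolding n powr_def by (simp del: of_real_add)
      then show ?thesis by (simp add: exp_minus divide_inverse)
    qed
    then show "integral\<^sup>L lborel (f k) = Gamma s * (1 / of_nat (Suc (Suc k)) powr s)"
      using G[of k] by (simp add: has_bochner_integral_iff mult.commute)
  qed
  then have "(\<lambda>k. Gamma s * (1 / of_nat (Suc (Suc k)) powr s)) sums (LINT x|lborel. (\<Sum>k. f k x))"
    using ds(5) by (simp only:)
  moreover have "summable (\<lambda>n. 1 / of_nat (Suc n) powr s)"
    using summable_dirichlet[OF assms] by (intro summable_norm_cancel[where f = "\<lambda>n. 1 / of_nat (Suc n) powr s", unfolded norm_dirichlet_term])
  then have "(\<lambda>k. 1 / of_nat (Suc (Suc k)) powr s) sums ((\<Sum>n. 1 / of_nat (Suc n) powr s) - 1)"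
    by (subst sums_Suc_iff) (simp add: summable_sums)
  then have "(\<lambda>k. Gamma s * (1 / of_nat (Suc (Suc k)) powr s)) sums (Gamma s * ((\<Sum>n. 1 / of_nat (Suc n) powr s) - 1))"
    by (rule sums_mult)
  ultimately have "(LINT x|lborel. (\<Sum>k. f k x)) = Gamma s * ((\<Sum>n. 1 / of_nat (Suc n) powr s) - 1)"
    by (rule sums_unique2)
  then show ?thesis using ds(4) unfolding has_bochner_integral_iff sum_f by blast
qed

lemma hankel_integral_dirichlet:
  assumes r: "0 < r" "r < 1/4" and s: "Re s > 1"
  shows "hankel_integral r (\<lambda>p. exp ((s - 1) * p) * zeta_kernel (exp p)) =
    2 * of_real pi * \<i> * exp (\<i> * of_real pi * s) * rGamma (1 - s) * ((\<Sum>n. 1 / of_nat (Suc n) powr s) - 1)"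
proof -
  note M = Mellin_zeta_kernel[OF s, unfolded has_bochner_integral_iff]
  have nz: "exp z \<noteq> 1" if "z \<in> ball 0 (1/4) - {0}" for z :: complex
    using norm_exp_minus_one_ge[of z] that by auto
  have "hankel_integral r (\<lambda>p. exp ((s - 1) * p) * zeta_kernel (exp p)) =
    (exp (2 * of_real pi * \<i> * s) - 1) * (Gamma s * ((\<Sum>n. 1 / of_nat (Suc n) powr s) - 1))"
  proof (subst hankel_integral_collapse[where R = "1/4" and B = "exp (1/4) * 3/2"])
    show "zeta_kernel holomorphic_on ball 0 (1/4) - {0}"
      unfolding zeta_kernel_def[abs_def] by (intro holomorphic_intros) (use nz in auto)
    fix z :: complex assume z: "z \<in> ball 0 (1/4) - {0}"
    have 1: "norm (exp z - 1) \<ge> 2/3 * norm z" using z by (intro norm_exp_minus_one_ge) auto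
    have "norm (exp (- z)) \<le> exp (norm (- z))" by (rule norm_exp)
    also have "\<dots> \<le> exp (1/4)" using z by simp
    finally have "norm (zeta_kernel z) \<le> exp (1/4) / (2/3 * norm z)"
      unfolding zeta_kernel_def norm_divide using 1 z by (intro frac_le) auto
    then show "norm (zeta_kernel z) \<le> exp (1/4) * 3/2 / norm z" by simp
  qed (use r s M in auto)
  then show ?thesis using exp_minus_one_mult_Gamma[of s] s by (simp flip: mult.assoc)
qed

lemma dirichlet_series_holomorphic:
  "(\<lambda>s. \<Sum>n. 1 / of_nat (Suc n) powr s) holomorphic_on {s::complex. Re s > 1}"
proof -
  have "\<exists>g g'. \<forall>x\<in>{s::complex. Re s > 1}. (\<lambda>n. 1 / of_nat (Suc n) powr x) sums g x \<and>
      (\<lambda>n. - ln (of_nat (Suc n)) * (1 / of_nat (Suc n) powr x)) sums g' x \<and> (g has_field_derivative g' x) (at x)"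
  proof (rule series_and_derivative_comparison_local)
    fix n and x :: complex
    show "((\<lambda>s. 1 / of_nat (Suc n) powr s) has_field_derivative - ln (of_nat (Suc n)) * (1 / of_nat (Suc n) powr x)) (at x)"
      by (auto intro!: derivative_eq_intros simp: field_simps power2_eq_square simp del: of_nat_Suc)
  next
    fix x :: complex assume x: "x \<in> {s. Re s > 1}"
    define \<sigma> where "\<sigma> = (1 + Re x) / 2"
    show "\<exists>d h. 0 < d \<and> summable h \<and> (\<forall>\<^sub>F n in sequentially. \<forall>y\<in>ball x d \<inter> {s. Re s > 1}. norm (1 / of_nat (Suc n) powr y) \<le> h n)"
    proof (intro exI conjI always_eventually allI ballI)
      show "0 < (Re x - 1) / 2" using x by simp
      show "summable (\<lambda>n. real (Suc n) powr (- \<sigma>))" using x by (intro summable_dirichlet) (simp add: \<sigma>_def)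
      fix n and y assume "y \<in> ball x ((Re x - 1) / 2) \<inter> {s. Re s > 1}"
      then have "norm (x - y) < (Re x - 1) / 2" by (simp add: dist_norm)
      then have "Re y \<ge> \<sigma>" using abs_Re_le_cmod[of "x - y"] unfolding \<sigma>_def minus_complex.sel by argo
      then show "norm (1 / of_nat (Suc n) powr y) \<le> real (Suc n) powr (- \<sigma>)"
        unfolding norm_dirichlet_term by (intro powr_mono) auto
    qed
  qed (simp add: open_halfspace_Re_gt)
  then obtain g g' where g: "\<And>x. Re x > 1 \<Longrightarrow> (\<lambda>n. 1 / of_nat (Suc n) powr x) sums g x"
    "\<And>x. Re x > 1 \<Longrightarrow> (g has_field_derivative g' x) (at x)" by blast
  have "g holomorphic_on {s. Re s > 1}"
    using g(2) by (auto simp: holomorphic_on_def field_differentiable_def intro: has_field_derivative_at_within)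
  then show ?thesis
    using sums_unique[OF g(1)] by (subst holomorphic_cong[OF refl]) auto
qed

text \<open>Solving the contour formula for zeta gives \<open>F\<close>, holomorphic except where
  \<open>Gamma (1 - s)\<close> has poles, at 1, 2, 3 and so on. The poles from 2 on are only
  apparent; no removable singularity argument is made, because there the Dirichlet series takes
  over. The two open sets leave out the point 1 alone.\<close>

lemma zeta_existence:
  "\<exists>f. f holomorphic_on - {1} \<and> (\<forall>s. Re s > 1 \<longrightarrow> (\<lambda>n. 1 / of_nat (Suc n) powr s) sums f s)"
proof -
  define A where "A = (\<lambda>s. hankel_integral (1/8) (\<lambda>p. exp ((s - 1) * p) * zeta_kernel (exp p)))"
  define F where "F = (\<lambda>s. 1 + A s * exp (- (\<i> * of_real pi * s)) * Gamma (1 - s) / (2 * of_real pi * \<i>))"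
  define L where "L = (\<lambda>s::complex. \<Sum>n. 1 / of_nat (Suc n) powr s)"
  define f where "f = (\<lambda>s. if Re s > 1 then L s else F s)"
  have holA: "A holomorphic_on UNIV" unfolding A_def by (rule hankel_zeta_holomorphic) auto
  define U where "U = {s::complex. 1 - s \<notin> \<int>\<^sub>\<le>\<^sub>0}"
  have U: "open U"
  proof -
    have "U = (\<lambda>s. 1 - s) -` (- \<int>\<^sub>\<le>\<^sub>0)" by (auto simp: U_def)
    moreover have "open (- \<int>\<^sub>\<le>\<^sub>0 :: complex set)" by (intro open_Compl closed_nonpos_Ints)
    ultimately show ?thesis by (auto intro!: open_vimage continuous_intros)
  qed
  have eq: "F s = L s" if "s \<in> U" "Re s > 1" for s
  proof -
    have "rGamma (1 - s) * Gamma (1 - s) = 1"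
      using that(1) by (simp add: U_def rGamma_inverse_Gamma Gamma_eq_zero_iff)
    moreover have "2 * of_real pi * \<i> * exp (\<i> * of_real pi * s) * rGamma (1 - s) * (L s - 1) *
        exp (- (\<i> * of_real pi * s)) * Gamma (1 - s) = 2 * of_real pi * \<i> * (L s - 1) *
        (exp (\<i> * of_real pi * s) * exp (- (\<i> * of_real pi * s))) * (rGamma (1 - s) * Gamma (1 - s))"
      by (simp only: mult_ac)
    ultimately have e: "2 * of_real pi * \<i> * exp (\<i> * of_real pi * s) * rGamma (1 - s) * (L s - 1) *
        exp (- (\<i> * of_real pi * s)) * Gamma (1 - s) = 2 * of_real pi * \<i> * (L s - 1)"
      by (simp only: exp_minus_inverse mult_1_right)
    have "A s = 2 * of_real pi * \<i> * exp (\<i> * of_real pi * s) * rGamma (1 - s) * (L s - 1)"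
      unfolding A_def L_def using that(2) by (intro hankel_integral_dirichlet) auto
    then show ?thesis unfolding F_def by (simp only: e) simp
  qed
  have "f holomorphic_on U \<union> {s. Re s > 1}"
  proof (rule holomorphic_on_Un)
    have "F holomorphic_on U"
      unfolding F_def
      by (intro holomorphic_intros holomorphic_Gamma' holomorphic_on_subset[OF holA])
         (auto simp: U_def)
    then show "f holomorphic_on U"
      by (rule holomorphic_transform) (auto simp: f_def eq)
    show "f holomorphic_on {s. Re s > 1}"
      using dirichlet_series_holomorphic by (rule holomorphic_transform) (auto simp: f_def L_def)
  qed (use U in \<open>auto simp: open_halfspace_Re_gt\<close>)
  moreover have "- {1} \<subseteq> U \<union> {s. Re s > 1}"
  proof
    fix s :: complex assume s: "s \<in> - {1}"
    show "s \<in> U \<union> {s. Re s > 1}"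
    proof (cases "s \<in> U")
      case False
      then have "1 - s \<in> \<int>\<^sub>\<le>\<^sub>0" by (simp add: U_def)
      then obtain n where n: "1 - s = of_int n" "n \<le> 0" by (auto elim!: nonpos_Ints_cases)
      have "s = 1 - (1 - s)" by simp
      also have "\<dots> = of_int (1 - n)" unfolding n by simp
      finally have "s = of_int (1 - n)" .
      moreover have "n \<noteq> 0" using calculation s by auto
      ultimately show ?thesis using n(2) by auto
    qed auto
  qed
  ultimately have "f holomorphic_on - {1}" using holomorphic_on_subset by blast
  moreover have "(\<lambda>n. 1 / of_nat (Suc n) powr s) sums f s" if "Re s > 1" for s
  proof -
    have "summable (\<lambda>n. 1 / of_nat (Suc n) powr s)"
      using summable_dirichlet[OF that] by (intro summable_norm_cancel[where f = "\<lambda>n. 1 / of_nat (Suc n) powr s", unfolded norm_dirichlet_term])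
    then show ?thesis using that by (simp add: f_def L_def summable_sums)
  qed
  ultimately show ?thesis by blast
qed

lemma zeta_holomorphic: "zeta holomorphic_on - {1}"
  and zeta_sums: "Re s > 1 \<Longrightarrow> (\<lambda>n. 1 / of_nat (Suc n) powr s) sums zeta s"
  using someI_ex[OF zeta_existence] unfolding zeta_def by blast+

text \<open>Identity theorem on the punctured plane, which is connected. At 1 the value of
  \<open>zeta\<close> is unspecified, and the factor \<open>rGamma 0\<close> would vanish.\<close>

lemma hankel_integral_zeta:
  assumes r: "0 < r" "r < 1/4" and s: "s \<noteq> 1"
  shows "hankel_integral r (\<lambda>p. exp ((s - 1) * p) * zeta_kernel (exp p)) =
    2 * of_real pi * \<i> * exp (\<i> * of_real pi * s) * rGamma (1 - s) * (zeta s - 1)"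
proof (rule analytic_continuation_open[where s = "{s. Re s > 1}" and s' = "- {1}"
    and f = "\<lambda>s. hankel_integral r (\<lambda>p. exp ((s - 1) * p) * zeta_kernel (exp p))"
    and g = "\<lambda>s. 2 * of_real pi * \<i> * exp (\<i> * of_real pi * s) * rGamma (1 - s) * (zeta s - 1)"])
  show "{s. Re s > 1} \<noteq> {}" by (auto intro!: exI[of _ 2])
  show "connected (- {1::complex})" by (intro connected_punctured_universe) simp
  show "(\<lambda>s. hankel_integral r (\<lambda>p. exp ((s - 1) * p) * zeta_kernel (exp p))) holomorphic_on - {1}"
    using hankel_zeta_holomorphic[OF r] holomorphic_on_subset by blast
  show "(\<lambda>s. 2 * of_real pi * \<i> * exp (\<i> * of_real pi * s) * rGamma (1 - s) * (zeta s - 1)) holomorphic_on - {1}"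
    by (intro holomorphic_intros zeta_holomorphic)
  fix z :: complex assume "z \<in> {s. Re s > 1}"
  then show "hankel_integral r (\<lambda>p. exp ((z - 1) * p) * zeta_kernel (exp p)) =
    2 * of_real pi * \<i> * exp (\<i> * of_real pi * z) * rGamma (1 - z) * (zeta z - 1)"
    using hankel_integral_dirichlet[OF r, of z] sums_unique[OF zeta_sums[of z]] by simp
qed (use s in \<open>auto simp: open_halfspace_Re_gt\<close>)

section \<open>The double integral\<close>

text \<open>The rate 5/4 is a compromise: any constant above 1 would do here, while the double integral
  needs its product with the bound 4/3 for exp (- w) on the contour to be below the decay rate 2
  of the zeta kernel.\<close>
lemma rGamma_shift_growth:
  fixes s :: complex
  obtains C where "C > 0" "\<And>k. norm (rGamma (s + of_nat k)) \<le> C * (5/4) ^ k / fact k"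
proof -
  define u where "u = (\<lambda>k. norm (rGamma (s + of_nat k)) * fact k)"
  \<comment> \<open>The threshold is the solution of 4 (k + 1) <= 5 (k - |s|). Beyond it the
    recursion for \<open>rGamma\<close> makes \<open>u\<close> grow by at most 5/4 per step; the
    finitely many earlier values are put into \<open>C\<close>.\<close>
  define N where "N = nat \<lceil>5 * norm s + 4\<rceil>"
  define C where "C = 1 + (\<Sum>j\<le>N. u j)"
  have u0: "u j \<ge> 0" for j by (simp add: u_def)
  have C: "C > 0" unfolding C_def using u0 by (intro add_pos_nonneg sum_nonneg) auto
  have step: "u (Suc k) \<le> 5/4 * u k" if "k \<ge> N" for k
  proof -
    have k: "real k \<ge> 5 * norm s + 4" using that unfolding N_def by linarith
    have "norm (of_nat k :: complex) - norm s \<le> norm (of_nat k + s)"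
      by (rule norm_diff_ineq)
    then have nz: "norm (s + of_nat k) \<ge> real k - norm s" by (simp add: add.commute)
    have "rGamma (s + of_nat k) = (s + of_nat k) * rGamma (s + of_nat (Suc k))"
      using rGamma_plus1[of "s + of_nat k"] by (simp add: add_ac)
    then have "norm (rGamma (s + of_nat k)) \<ge> (real k - norm s) * norm (rGamma (s + of_nat (Suc k)))"
      using nz by (simp add: norm_mult mult_right_mono)
    moreover have "(real k - norm s) * 5 \<ge> 4 * (real k + 1)" using k by simp
    then have "4 * (real k + 1) * norm (rGamma (s + of_nat (Suc k))) \<le> ((real k - norm s) * 5) * norm (rGamma (s + of_nat (Suc k)))"
      by (intro mult_right_mono) auto
    ultimately have "(real k + 1) * norm (rGamma (s + of_nat (Suc k))) \<le> 5/4 * norm (rGamma (s + of_nat k))"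
      by (simp add: algebra_simps)
    then have "(real k + 1) * norm (rGamma (s + of_nat (Suc k))) * fact k \<le> 5/4 * norm (rGamma (s + of_nat k)) * fact k"
      by (intro mult_right_mono) auto
    then show ?thesis by (simp add: u_def mult_ac add_ac)
  qed
  have "u k \<le> C * (5/4) ^ k" for k
  proof (induction k)
    case 0
    have "u 0 \<le> (\<Sum>j\<le>N. u j)" using u0 by (intro member_le_sum) auto
    then show ?case by (simp add: C_def)
  next
    case (Suc k)
    show ?case
    proof (cases "k \<ge> N")
      case True
      then show ?thesis using step[of k] Suc by simp
    next
      case False
      have "u (Suc k) \<le> (\<Sum>j\<le>N. u j)" using u0 False by (intro member_le_sum) auto
      also have "\<dots> \<le> C * 1" by (simp add: C_def)
      also have "\<dots> \<le> C * (5/4) ^ Suc k" using C by (intro mult_left_mono one_le_power) auto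
      finally show ?thesis .
    qed
  qed
  then have "norm (rGamma (s + of_nat k)) \<le> C * (5/4) ^ k / fact k" for k
    by (simp add: u_def pos_le_divide_eq)
  then show ?thesis by (rule that[OF C])
qed

text \<open>Comparison with the exponential series of \<open>5/4 * norm x\<close>. The bound
  concerns partial sums of norms since that is how \<open>dominated_series\<close> takes its
  majorant.\<close>

lemma sum_rGamma_shift_le:
  fixes s :: complex
  obtains C where "C > 0"
    "\<And>n x. (\<Sum>k<n. norm (x ^ Suc k * rGamma (s + of_nat (Suc k)))) \<le> C * exp (5/4 * norm x)"
proof -
  obtain C where C: "C > 0" "\<And>k. norm (rGamma (s + of_nat k)) \<le> C * (5/4) ^ k / fact k"
    using rGamma_shift_growth by blast
  have "(\<Sum>k<n. norm (x ^ Suc k * rGamma (s + of_nat (Suc k)))) \<le> C * exp (5/4 * norm x)" for n x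
  proof -
    have "(\<Sum>k<n. norm (x ^ Suc k * rGamma (s + of_nat (Suc k)))) \<le> (\<Sum>k<n. C * ((5/4 * norm x) ^ Suc k / fact (Suc k)))"
    proof (rule sum_mono)
      fix k
      have "norm (x ^ Suc k * rGamma (s + of_nat (Suc k))) \<le> norm x ^ Suc k * (C * (5/4) ^ Suc k / fact (Suc k))"
        unfolding norm_mult norm_power by (intro mult_left_mono C) auto
      then show "norm (x ^ Suc k * rGamma (s + of_nat (Suc k))) \<le> C * ((5/4 * norm x) ^ Suc k / fact (Suc k))"
        by (simp add: power_mult_distrib power_divide mult_ac del: power_Suc fact_Suc)
    qed
    also have "\<dots> = C * (\<Sum>k\<in>Suc ` {..<n}. (5/4 * norm x) ^ k / fact k)"
      by (subst sum.reindex) (auto simp: sum_distrib_left)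
    also have "\<dots> \<le> C * (\<Sum>k. (5/4 * norm x) ^ k / fact k)"
      using C(1) summable_exp[of "5/4 * norm x"]
      by (intro mult_left_mono sum_le_suminf) (auto simp: field_simps)
    also have "(\<lambda>k. (5/4 * norm x) ^ k / fact k) = (\<lambda>k. (5/4 * norm x) ^ k /\<^sub>R fact k)"
      by (simp only: divide_inverse real_scaleR_def mult.commute)
    also have "C * suminf \<dots> = C * exp (5/4 * norm x)" unfolding exp_def ..
    finally show ?thesis .
  qed
  then show ?thesis by (rule that[OF C(1)])
qed

text \<open>On the circle Re w can be negative, so 1 is not a bound; the small radius limits the
  excess to exp (1/4).\<close>

lemma norm_exp_minus_exp_hankel_log_le:
  assumes "0 < r" "r < 1/4"
  shows "norm (exp (- exp (hankel_log r t))) \<le> 4/3"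
proof -
  have "norm (exp (- exp (hankel_log r t))) \<le> exp (2 * r) * exp (- exp (Re (hankel_log r t)))"
    using norm_exp_mult_exp_hankel_log[OF assms(1), of 1 t] by simp
  also have "\<dots> \<le> exp (1/4)"
    using exp_Re_hankel_log_ge(1)[OF assms(1), of t] assms by (simp flip: exp_add)
  also note exp_quarter_le
  finally show ?thesis .
qed

text \<open>The coefficient of \<open>y ^ Suc k\<close> in the \<open>v\<close>-integral, regarded
  as a power series in y = exp (- w). The shift by \<open>Suc\<close> reflects that the series
  begins at 1.\<close>

definition inner_coeff :: "real \<Rightarrow> complex \<Rightarrow> nat \<Rightarrow> complex" where
  "inner_coeff r s k = rGamma (s + of_nat (Suc k)) *
     hankel_integral r (\<lambda>p. exp ((s + of_nat (Suc k) - 1) * p) * zeta_kernel (exp p))"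

text \<open>The \<open>v\<close>-part of \<open>kernel\<close>, with exp (- w) replaced by a free
  variable \<open>y\<close>; inside the \<open>v\<close>-integral \<open>w\<close> then enters only
  through \<open>y\<close>.\<close>

definition inner_integrand :: "complex \<Rightarrow> complex \<Rightarrow> complex \<Rightarrow> complex" where
  "inner_integrand s y p = exp ((s - 1) * p) * zeta_kernel (exp p) *
     (\<Sum>k. (exp p * y) ^ Suc k * rGamma (s + of_nat (Suc k)))"

text \<open>The third conclusion is later taken at y = 4/3, the worst value on the
  \<open>w\<close>-contour, where it yields one majorant for all \<open>w\<close>.\<close>

lemma hankel_inner:
  assumes r: "0 < r" "r < 1/4" and y: "norm y \<le> 4/3"
  shows "hankel_integrable r (inner_integrand s y)"
    and "(\<lambda>k. inner_coeff r s k * y ^ Suc k) sums hankel_integral r (inner_integrand s y)"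
    and "summable (\<lambda>k. norm (inner_coeff r s k * y ^ Suc k))"
proof -
  obtain C where C: "C > 0"
    "\<And>n x. (\<Sum>k<n. norm (x ^ Suc k * rGamma (s + of_nat (Suc k)))) \<le> C * exp (5/4 * norm x)"
    using sum_rGamma_shift_le by blast
  obtain Z where Z: "Z > 0"
    "\<And>t. norm (zeta_kernel (exp (hankel_log r t))) \<le> Z * exp (- 2 * exp (Re (hankel_log r t)))"
    using zeta_kernel_hankel_bound[OF r] by blast
  \<comment> \<open>The rate 5/3 = 5/4 * 4/3 is the growth of the series in modulus. Against the
    decay rate 2 it leaves 1/3, of which half is spent on the power of v; hence the 1/6
    below.\<close>
  define g where "g = (\<lambda>p. zeta_kernel (exp p) * of_real (exp (5/3 * exp (Re p))))"
  have g: "norm (g (hankel_log r t)) \<le> Z * exp (- (1/3) * exp (Re (hankel_log r t)))" for t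
  proof -
    let ?e = "exp (Re (hankel_log r t))"
    have "norm (g (hankel_log r t)) \<le> Z * exp (- 2 * ?e) * exp (5/3 * ?e)"
      unfolding g_def norm_mult norm_of_real using Z(1) by (intro mult_mono Z(2)) auto
    also have "\<dots> = Z * exp (- (1/3) * ?e)" by (simp add: mult.assoc flip: exp_add)
    finally show ?thesis .
  qed
  obtain B where B: "B \<ge> 0" "\<And>s' t. norm s' \<le> norm (s - 1) \<Longrightarrow>
      norm (exp (s' * hankel_log r t) * g (hankel_log r t) * hankel_deriv r t) \<le> B * exp (- (1/6) * exp (Re (hankel_log r t)))"
    using exp_mult_hankel_log_integrand_bound[OF r(1) _ _ g, of "1/6" "norm (s - 1)"] by auto
  define f where "f = (\<lambda>k t. exp ((s - 1) * hankel_log r t) * zeta_kernel (exp (hankel_log r t)) *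
     ((exp (hankel_log r t) * y) ^ Suc k * rGamma (s + of_nat (Suc k))) * hankel_deriv r t)"
  have meas: "f k \<in> borel_measurable lborel" for k
    unfolding f_def by measurable
  define x where "x = (\<lambda>t. exp (hankel_log r t) * y)"
  have bd: "(\<Sum>k<n. norm (f k t)) \<le> C * B * exp (- (1/6) * exp (Re (hankel_log r t)))" for n t
  proof -
    let ?e = "exp (Re (hankel_log r t))"
    let ?h = "norm (exp ((s - 1) * hankel_log r t) * zeta_kernel (exp (hankel_log r t)) * hankel_deriv r t)"
    have "(\<Sum>k<n. norm (f k t)) = ?h * (\<Sum>k<n. norm (x t ^ Suc k * rGamma (s + of_nat (Suc k))))"
      unfolding sum_distrib_left f_def x_def by (simp only: norm_mult mult_ac)
    also have "\<dots> \<le> ?h * (C * exp (5/4 * norm (x t)))" by (intro mult_left_mono C) auto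
    also have "\<dots> \<le> ?h * (C * exp (5/3 * ?e))"
    proof -
      have "norm (x t) \<le> ?e * (4/3)" unfolding x_def norm_mult using y by (intro mult_mono) auto
      then show ?thesis using C(1) by (intro mult_left_mono) auto
    qed
    also have "\<dots> = C * norm (exp ((s - 1) * hankel_log r t) * g (hankel_log r t) * hankel_deriv r t)"
      by (simp add: g_def norm_mult mult_ac)
    also have "\<dots> \<le> C * (B * exp (- (1/6) * ?e))" using C(1) by (intro mult_left_mono B) auto
    finally show ?thesis by (simp add: mult.assoc)
  qed
  have "integrable lborel (\<lambda>t. C * B * exp (- (1/6) * exp (Re (hankel_log r t))))"
    using r(1) by (intro integrable_exp_neg_hankel) auto
  note ds = dominated_series[OF meas this bd]
  have sum_f: "(\<Sum>k. f k t) = inner_integrand s y (hankel_log r t) * hankel_deriv r t" for t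
  proof -
    have sm: "summable (\<lambda>k. x t ^ Suc k * rGamma (s + of_nat (Suc k)))"
      by (rule summable_norm_cancel, rule summableI_nonneg_bounded[OF _ C(2)]) auto
    have "(\<lambda>k. f k t) sums (exp ((s - 1) * hankel_log r t) * zeta_kernel (exp (hankel_log r t)) *
      (\<Sum>k. x t ^ Suc k * rGamma (s + of_nat (Suc k))) * hankel_deriv r t)"
      unfolding f_def x_def by (intro sums_mult sums_mult2 summable_sums sm[unfolded x_def])
    then show ?thesis unfolding inner_integrand_def x_def by (rule sums_unique[symmetric])
  qed
  have int_f: "integral\<^sup>L lborel (f k) = inner_coeff r s k * y ^ Suc k" for k
  proof -
    \<comment> \<open>The factor \<open>exp p ^ Suc k\<close> merges with the power of v and shifts
      its exponent, so each term is the contour integral for zeta at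
      \<open>s + of_nat (Suc k)\<close>.\<close>
    have fk: "f k t = (rGamma (s + of_nat (Suc k)) * y ^ Suc k) *
       (exp ((s + of_nat (Suc k) - 1) * hankel_log r t) * zeta_kernel (exp (hankel_log r t)) * hankel_deriv r t)" for t
    proof -
      have "(s + of_nat (Suc k) - 1) * hankel_log r t = (s - 1) * hankel_log r t + of_nat (Suc k) * hankel_log r t"
        by (simp add: algebra_simps)
      then have "exp ((s + of_nat (Suc k) - 1) * hankel_log r t) = exp ((s - 1) * hankel_log r t) * exp (hankel_log r t) ^ Suc k"
        by (simp only: exp_add exp_of_nat_mult)
      then show ?thesis unfolding f_def by (simp only: power_mult_distrib mult_ac)
    qed
    show ?thesis unfolding inner_coeff_def hankel_integral_def
      by (subst Bochner_Integration.integral_cong[OF refl fk], subst integral_mult_right_zero) (simp only: mult_ac)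
  qed
  show "hankel_integrable r (inner_integrand s y)"
    using ds(4) unfolding hankel_integrable_def sum_f by auto
  show "(\<lambda>k. inner_coeff r s k * y ^ Suc k) sums hankel_integral r (inner_integrand s y)"
    using ds(5) unfolding int_f hankel_integral_def sum_f by auto
  have "summable (\<lambda>k. LINT t|lborel. norm (f k t))" using ds(3) by auto
  then show "summable (\<lambda>k. norm (inner_coeff r s k * y ^ Suc k))"
  proof (rule summable_comparison_test'[where N = 0])
    fix k
    show "norm (norm (inner_coeff r s k * y ^ Suc k)) \<le> (LINT t|lborel. norm (f k t))"
      unfolding int_f[symmetric] real_norm_def abs_norm_cancel by (rule integral_norm_bound)
  qed
qed

lemma kernel_eq_inner_integrand:
  "kernel s1 s2 lam p q = exp ((s2 - 1) * q) * exp (- (lam * exp q)) * inner_integrand s1 (exp (- exp q)) p"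
  unfolding kernel_def inner_integrand_def zeta_kernel_def Let_def rGamma_inverse_Gamma
  by (simp add: exp_add exp_minus divide_inverse mult_ac)

text \<open>Termwise, the \<open>w\<close>-integral is Hankel's formula with a = k + lam, k >= 1,
  whose real part is positive. The point is a majorant uniform in \<open>k\<close>, although exp (-
  lam w) alone need not decay.\<close>

lemma hankel_outer:
  assumes rv: "0 < rv" "rv < 1/4" and rw: "0 < rw" "rw < 1/4" and lam: "Re lam > -1"
  shows "double_hankel_converges rv rw s1 s2 lam"
    and "(\<lambda>k. inner_coeff rv s1 k * (2 * of_real pi * \<i> * exp (\<i> * of_real pi * s2) * rGamma (1 - s2) *
           exp (- s2 * Ln (of_nat (Suc k) + lam)))) sums
         hankel_integral rw (\<lambda>q. hankel_integral rv (\<lambda>p. kernel s1 s2 lam p q))"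
proof -
  define q where "q = hankel_log rw"
  have [measurable]: "q \<in> borel_measurable borel" unfolding q_def by measurable
  define y where "y = (\<lambda>t. exp (- exp (q t)))"
  have y: "norm (y t) \<le> 4/3" for t unfolding y_def q_def by (rule norm_exp_minus_exp_hankel_log_le[OF rw])
  have yq: "exp (- exp (q t)) = y t" for t by (simp add: y_def)
  note inner = hankel_inner[OF rv y]
  have inner_int: "hankel_integrable rv (\<lambda>p. kernel s1 s2 lam p (q t))" for t
    using inner(1)[of s1 t] unfolding kernel_eq_inner_integrand yq hankel_integrable_def
    by (simp add: mult.assoc)
  define f where "f = (\<lambda>k t. exp ((s2 - 1) * q t) * exp (- (lam * exp (q t))) * (inner_coeff rv s1 k * y t ^ Suc k) * hankel_deriv rw t)"
  have meas: "f k \<in> borel_measurable lborel" for k unfolding f_def y_def by measurable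
  have sum_f: "(\<lambda>k. f k t) sums (hankel_integral rv (\<lambda>p. kernel s1 s2 lam p (q t)) * hankel_deriv rw t)" for t
  proof -
    have "hankel_integral rv (\<lambda>p. kernel s1 s2 lam p (q t)) = exp ((s2 - 1) * q t) * exp (- (lam * exp (q t))) * hankel_integral rv (inner_integrand s1 (y t))"
      unfolding kernel_eq_inner_integrand yq hankel_integral_def by (simp add: mult.assoc)
    then show ?thesis unfolding f_def using inner(2)[of s1 t] by (auto intro: sums_mult sums_mult2)
  qed
  \<comment> \<open>The exponent is \<open>k\<close>, not \<open>Suc k\<close>: one factor
    \<open>y t\<close> is held back and joins exp (- lam w) to form \<open>g\<close>, which decays
    at the rate Re (lam + 1). The other \<open>k\<close> factors are estimated by 4/3 each.\<close>
  define S where "S = (\<Sum>k. norm (inner_coeff rv s1 k) * (4/3) ^ k)"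
  have summ: "summable (\<lambda>k. norm (inner_coeff rv s1 k) * (4/3) ^ k)"
  proof -
    have "summable (\<lambda>k. norm (inner_coeff rv s1 k * (4/3) ^ Suc k))" by (intro hankel_inner(3)[OF rv]) simp
    then have "summable (\<lambda>k. 3/4 * norm (inner_coeff rv s1 k * (4/3) ^ Suc k))" by (rule summable_mult)
    then show ?thesis by (simp add: norm_mult norm_power)
  qed
  have S0: "S \<ge> 0" unfolding S_def by (intro suminf_nonneg summ) auto
  define g where "g = (\<lambda>p::complex. exp (- ((lam + 1) * exp p)))"
  have g: "norm (g (hankel_log rw t)) \<le> exp (2 * norm (lam + 1) * rw) * exp (- Re (lam + 1) * exp (Re (hankel_log rw t)))" for t
    unfolding g_def by (rule norm_exp_mult_exp_hankel_log[OF rw(1)])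
  define c where "c = Re (lam + 1) / 2"
  have c: "c > 0" "Re (lam + 1) > 0" "c < Re (lam + 1)" using lam by (auto simp: c_def)
  obtain B where B: "B \<ge> 0" "\<And>s' t. norm s' \<le> norm (s2 - 1) \<Longrightarrow>
      norm (exp (s' * hankel_log rw t) * g (hankel_log rw t) * hankel_deriv rw t) \<le> B * exp (- c * exp (Re (hankel_log rw t)))"
    using exp_mult_hankel_log_integrand_bound[OF rw(1) c(2,3) g, where M = "norm (s2 - 1)"] by auto
  have bd: "(\<Sum>k<n. norm (f k t)) \<le> S * B * exp (- c * exp (Re (hankel_log rw t)))" for n t
  proof -
    let ?h = "norm (exp ((s2 - 1) * q t) * g (q t) * hankel_deriv rw t)"
    have e: "exp (- (lam * exp (q t))) * y t = g (q t)"
      unfolding y_def g_def by (simp add: algebra_simps flip: exp_add)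
    have "f k t = (exp ((s2 - 1) * q t) * (exp (- (lam * exp (q t))) * y t) * hankel_deriv rw t) * (inner_coeff rv s1 k * y t ^ k)" for k
      unfolding f_def by (simp add: mult_ac)
    then have "(\<Sum>k<n. norm (f k t)) = ?h * (\<Sum>k<n. norm (inner_coeff rv s1 k * y t ^ k))"
      unfolding e sum_distrib_left by (simp add: norm_mult)
    also have "\<dots> \<le> ?h * (\<Sum>k<n. norm (inner_coeff rv s1 k) * (4/3) ^ k)"
      unfolding norm_mult norm_power using y by (intro mult_left_mono sum_mono power_mono) auto
    also have "\<dots> \<le> ?h * S"
      unfolding S_def by (intro mult_left_mono sum_le_suminf summ) auto
    also have "\<dots> \<le> (B * exp (- c * exp (Re (hankel_log rw t)))) * S"
      unfolding q_def by (intro mult_right_mono B S0) auto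
    finally show ?thesis by (simp add: mult_ac)
  qed
  note ds = dominated_series[OF meas integrable_exp_neg_hankel[OF c(1) rw(1)] bd]
  note sf = sums_unique[OF sum_f, symmetric]
  show "double_hankel_converges rv rw s1 s2 lam"
    unfolding double_hankel_converges_def hankel_integrable_def[of rw]
    using inner_int ds(4) unfolding sf q_def by simp
  have int_f: "integral\<^sup>L lborel (f k) = inner_coeff rv s1 k * (2 * of_real pi * \<i> * exp (\<i> * of_real pi * s2) * rGamma (1 - s2) *
           exp (- s2 * Ln (of_nat (Suc k) + lam)))" for k
  proof -
    have fk: "f k t = inner_coeff rv s1 k * (exp ((s2 - 1) * q t) * exp (- ((of_nat (Suc k) + lam) * exp (q t))) * hankel_deriv rw t)" for t
    proof -
      have "- ((of_nat (Suc k) + lam) * exp (q t)) = - (lam * exp (q t)) + of_nat (Suc k) * (- exp (q t))"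
        by (simp add: algebra_simps)
      then have "exp (- ((of_nat (Suc k) + lam) * exp (q t))) = exp (- (lam * exp (q t))) * y t ^ Suc k"
        unfolding y_def by (simp only: exp_add exp_of_nat_mult)
      then show ?thesis unfolding f_def by (simp only: mult_ac)
    qed
    have "integral\<^sup>L lborel (f k) = inner_coeff rv s1 k * hankel_integral rw (\<lambda>q. exp ((s2 - 1) * q) * exp (- ((of_nat (Suc k) + lam) * exp q)))"
      unfolding hankel_integral_def q_def[symmetric]
      by (subst Bochner_Integration.integral_cong[OF refl fk], subst integral_mult_right_zero) simp
    also have "hankel_integral rw (\<lambda>q. exp ((s2 - 1) * q) * exp (- ((of_nat (Suc k) + lam) * exp q))) =
      2 * of_real pi * \<i> * exp (\<i> * of_real pi * s2) * rGamma (1 - s2) * exp (- s2 * Ln (of_nat (Suc k) + lam))"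
      using lam by (intro hankel_integral_Gamma[OF rw(1)]) simp
    finally show ?thesis .
  qed
  show "(\<lambda>k. inner_coeff rv s1 k * (2 * of_real pi * \<i> * exp (\<i> * of_real pi * s2) * rGamma (1 - s2) *
           exp (- s2 * Ln (of_nat (Suc k) + lam)))) sums
         hankel_integral rw (\<lambda>q. hankel_integral rv (\<lambda>p. kernel s1 s2 lam p q))"
  proof -
    have "hankel_integral rw (\<lambda>q. hankel_integral rv (\<lambda>p. kernel s1 s2 lam p q)) = (LINT t|lborel. (\<Sum>k. f k t))"
      by (simp only: sf hankel_integral_def[of rw] q_def)
    with ds(5) show ?thesis by (simp only: int_f)
  qed
qed

text \<open>With z = s + k + 1, the reflection formula turns
  \<open>rGamma z * rGamma (1 - z)\<close> into a sine, which becomes exp (2 pi i z) - 1;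
  periodicity replaces z by s. Excluding nonpositive integers \<open>s\<close> keeps z away from
  1.\<close>

lemma inner_coeff_eq:
  assumes r: "0 < r" "r < 1/4" and s: "s \<notin> \<int>\<^sub>\<le>\<^sub>0"
  shows "inner_coeff r s k = (exp (2 * of_real pi * \<i> * s) - 1) * (zeta (s + of_nat (Suc k)) - 1)"
proof -
  define z where "z = s + of_nat (Suc k)"
  have "z \<noteq> 1"
  proof
    assume "z = 1"
    then have "s + of_nat k = 0" by (simp add: z_def)
    then have "s = - of_nat k" by (simp add: eq_neg_iff_add_eq_0)
    with s show False by simp
  qed
  have "inner_coeff r s k = rGamma z * (2 * of_real pi * \<i> * exp (\<i> * of_real pi * z) * rGamma (1 - z) * (zeta z - 1))"
    unfolding inner_coeff_def z_def[symmetric] hankel_integral_zeta[OF r \<open>z \<noteq> 1\<close>] ..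
  also have "\<dots> = 2 * of_real pi * \<i> * exp (\<i> * of_real pi * z) * (rGamma z * rGamma (1 - z)) * (zeta z - 1)"
    by (simp only: mult_ac)
  also have "\<dots> = 2 * \<i> * exp (\<i> * of_real pi * z) * sin (of_real pi * z) * (zeta z - 1)"
    unfolding rGamma_reflection_complex by simp
  also have "2 * \<i> * exp (\<i> * of_real pi * z) * sin (of_real pi * z) = exp (2 * of_real pi * \<i> * z) - 1"
    by (simp add: sin_exp_eq field_simps exp_minus flip: exp_add)
  also have "exp (2 * of_real pi * \<i> * z) = exp (2 * of_real pi * \<i> * s)"
  proof -
    have "2 * of_real pi * \<i> * z = 2 * of_real pi * \<i> * s + of_nat (Suc k) * (2 * of_real pi * \<i>)"
      by (simp add: z_def algebra_simps)
    then show ?thesis by (simp only: exp_add exp_of_nat_mult exp_two_pi_i power_one mult_1_right)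
  qed
  finally show ?thesis unfolding z_def .
qed

text \<open>The two exclusions make the prefactor cancel: for \<open>s1\<close> not an integer, exp
  (2 pi i s1) - 1 is nonzero; for \<open>s2\<close> not a positive integer,
  \<open>Gamma (1 - s2)\<close> is a genuine inverse of \<open>rGamma (1 - s2)\<close>.\<close>

lemma D_series_eq_hankel_rep:
  assumes rv: "0 < rv" "rv < 1/4" and rw: "0 < rw" "rw < 1/4" and lam: "Re lam > -1"
    and s1: "s1 \<notin> \<int>" and s2: "s2 \<notin> of_nat ` {1..}"
  shows "D_series s1 s2 lam = hankel_rep rv rw s1 s2 lam"
proof -
  define E where "E = exp (2 * of_real pi * \<i> * s1) - 1"
  have E: "E \<noteq> 0"
  proof
    assume "E = 0"
    then have "exp (2 * of_real pi * \<i> * s1) = 1" by (simp add: E_def)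
    then obtain n where "Im (2 * of_real pi * \<i> * s1) = of_int (2 * n) * pi" "Re (2 * of_real pi * \<i> * s1) = 0"
      unfolding exp_eq_1 by blast
    then have "s1 = of_int n" by (auto simp: complex_eq_iff)
    with s1 show False by simp
  qed
  have "s1 \<notin> \<int>\<^sub>\<le>\<^sub>0" using s1 nonpos_Ints_Int by blast
  note ic = inner_coeff_eq[OF rv this]
  have "1 - s2 \<notin> \<int>\<^sub>\<le>\<^sub>0"
  proof
    assume "1 - s2 \<in> \<int>\<^sub>\<le>\<^sub>0"
    then obtain n :: nat where n: "1 - s2 = - of_nat n" by (auto elim: nonpos_Ints_cases')
    have "s2 = 1 - (1 - s2)" by simp
    also have "\<dots> = of_nat (Suc n)" unfolding n by simp
    finally have "s2 = of_nat (Suc n)" .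
    then have "s2 \<in> of_nat ` {1..}" by (rule image_eqI) simp
    with s2 show False by contradiction
  qed
  then have G: "Gamma (1 - s2) * rGamma (1 - s2) = 1" by (simp add: rGamma_inverse_Gamma Gamma_eq_zero_iff)
  define K where "K = exp (- of_real pi * \<i> * s2) * Gamma (1 - s2) / (2 * of_real pi * \<i> * E)"
  have D: "D_term s1 s2 lam (Suc k) = K * (inner_coeff rv s1 k * (2 * of_real pi * \<i> * exp (\<i> * of_real pi * s2) * rGamma (1 - s2) *
           exp (- s2 * Ln (of_nat (Suc k) + lam))))" for k
  proof -
    have "of_nat (Suc k) + lam \<noteq> 0"
    proof
      assume "of_nat (Suc k) + lam = 0"
      then have "Re (of_nat (Suc k) + lam) = 0" by simp
      then show False using lam by simp
    qed
    then have "D_term s1 s2 lam (Suc k) = (zeta (s1 + of_nat (Suc k)) - 1) * exp (- s2 * Ln (of_nat (Suc k) + lam))"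
      by (simp add: D_term_def powr_def exp_minus divide_inverse)
    moreover have "K * (E * (zeta (s1 + of_nat (Suc k)) - 1) * (2 * of_real pi * \<i> * exp (\<i> * of_real pi * s2) * rGamma (1 - s2) *
           exp (- s2 * Ln (of_nat (Suc k) + lam)))) =
      (exp (\<i> * of_real pi * s2) * exp (- (\<i> * of_real pi * s2))) * (Gamma (1 - s2) * rGamma (1 - s2)) *
      ((zeta (s1 + of_nat (Suc k)) - 1) * exp (- s2 * Ln (of_nat (Suc k) + lam)))"
      using E by (simp add: K_def mult_ac)
    ultimately show ?thesis unfolding ic E_def[symmetric] by (simp only: G exp_minus_inverse mult_1_left)
  qed
  have "(\<lambda>k. D_term s1 s2 lam (Suc k)) sums (K * hankel_integral rw (\<lambda>q. hankel_integral rv (\<lambda>p. kernel s1 s2 lam p q)))"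
    unfolding D by (intro sums_mult hankel_outer(2)[OF rv rw lam])
  then show ?thesis unfolding D_series_def hankel_rep_def K_def E_def by (rule sums_unique[symmetric])
qed

section \<open>The series as a function of its parameters\<close>

text \<open>For n >= 2 and Re s >= 2 the power of n with nonpositive exponent 2 - Re s is at most
  that of 2. Pulling it out of every term leaves the convergent sum of 1 / n^2.\<close>

lemma norm_zeta_minus_one_le:
  obtains K where "K > 0" "\<And>s. Re s \<ge> 2 \<Longrightarrow> norm (zeta s - 1) \<le> K * 2 powr (- Re s)"
proof -
  define T where "T = (\<Sum>k. real (Suc (Suc k)) powr (- 2))"
  have smT: "summable (\<lambda>k. real (Suc (Suc k)) powr (- 2))"
    using summable_dirichlet[of 2] by (subst summable_Suc_iff[of "\<lambda>n. real (Suc n) powr (- 2)"]) simp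
  have T0: "T \<ge> 0" unfolding T_def by (intro suminf_nonneg smT) simp
  have "norm (zeta s - 1) \<le> (4 * T + 1) * 2 powr (- Re s)" if s: "Re s \<ge> 2" for s
  proof -
    have "(\<lambda>k. 1 / of_nat (Suc (Suc k)) powr s) sums (zeta s - 1)"
      using zeta_sums[of s] s by (subst sums_Suc_iff) simp
    then have eq: "zeta s - 1 = (\<Sum>k. 1 / of_nat (Suc (Suc k)) powr s)" by (rule sums_unique)
    have bd: "norm (1 / of_nat (Suc (Suc k)) powr s) \<le> 2 powr (2 - Re s) * real (Suc (Suc k)) powr (- 2)" for k
    proof -
      have "norm (1 / of_nat (Suc (Suc k)) powr s) = real (Suc (Suc k)) powr (- 2) * real (Suc (Suc k)) powr (2 - Re s)"
        unfolding norm_dirichlet_term by (simp only: powr_add[symmetric]) simp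
      also have "\<dots> \<le> real (Suc (Suc k)) powr (- 2) * 2 powr (2 - Re s)"
        using s by (intro mult_left_mono powr_mono2') auto
      finally show ?thesis by (simp only: mult.commute)
    qed
    have "norm (zeta s - 1) \<le> (\<Sum>k. 2 powr (2 - Re s) * real (Suc (Suc k)) powr (- 2))"
      unfolding eq by (rule norm_suminf_le[OF bd summable_mult[OF smT]])
    also have "\<dots> = 2 powr (2 - Re s) * T" unfolding T_def by (rule suminf_mult[OF smT])
    also have "\<dots> = 4 * T * 2 powr (- Re s)" by (simp add: powr_diff powr_minus divide_inverse)
    also have "\<dots> \<le> (4 * T + 1) * 2 powr (- Re s)" by (intro mult_right_mono) auto
    finally show ?thesis .
  qed
  moreover have "4 * T + 1 > 0" using T0 by simp
  ultimately show ?thesis by (rule that[rotated])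
qed

lemma norm_Ln_le:
  assumes "1 \<le> norm z" "norm z \<le> B"
  shows "norm (Ln z) \<le> ln B + pi"
proof -
  have z: "z \<noteq> 0" using assms by auto
  have "norm (Ln z) \<le> \<bar>Re (Ln z)\<bar> + \<bar>Im (Ln z)\<bar>" by (rule cmod_le)
  also have "\<bar>Re (Ln z)\<bar> = ln (norm z)" using z assms by (simp add: Re_Ln)
  also have "ln (norm z) \<le> ln B" using assms by (intro ln_mono) auto
  also have "\<bar>Im (Ln z)\<bar> \<le> pi" using z Im_Ln_le_pi[of z] mpi_less_Im_Ln[of z] by auto
  finally show ?thesis by simp
qed

text \<open>The zeta factor decays like (1/2)^k, while the power of k + lam grows subexponentially
  and is bounded by a multiple of (3/2)^k; the product gives 3/4. The threshold depends only on
  \<open>M\<close>, so the bound is uniform in all three parameters.\<close>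

lemma D_term_bound:
  fixes M :: real
  obtains C N where "C > 0"
    "\<And>k s1 s2 lam. k \<ge> N \<Longrightarrow> norm s1 \<le> M \<Longrightarrow> norm s2 \<le> M \<Longrightarrow> norm lam \<le> M \<Longrightarrow>
      norm (D_term s1 s2 lam (Suc k)) \<le> C * (3/4) ^ k"
proof (cases "M \<ge> 0")
  case False
  show ?thesis
  proof (rule that[of 1 0])
    fix k :: nat and s1 s2 lam :: complex assume "norm s1 \<le> M"
    then show "norm (D_term s1 s2 lam (Suc k)) \<le> 1 * (3/4) ^ k" using False norm_ge_zero[of s1] by linarith
  qed simp
next
  case M: True
  obtain K where K: "K > 0" "\<And>s. Re s \<ge> 2 \<Longrightarrow> norm (zeta s - 1) \<le> K * 2 powr (- Re s)"
    using norm_zeta_minus_one_le by blast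
  obtain G where G: "G > 0" "\<And>\<rho>. \<rho> \<ge> 1 \<Longrightarrow> exp (M * (\<bar>ln \<rho>\<bar> + 2*pi)) \<le> G * exp (ln (3/2) * \<rho>)"
    using exp_ln_growth[OF M, of "ln (3/2)" 1] by auto
  \<comment> \<open>Beyond M + 2 the argument of zeta has real part at least 2, and k + 1 + lam has
    modulus at least 1, so its logarithm has nonnegative real part.\<close>
  define N where "N = nat \<lceil>M + 2\<rceil>"
  define C where "C = K * 2 powr M * G * (3/2) powr (1 + M)"
  show ?thesis
  proof (rule that[of C N])
    show "C > 0" using K(1) G(1) by (simp add: C_def)
    fix k :: nat and s1 s2 lam :: complex
    assume k: "k \<ge> N" and s1: "norm s1 \<le> M" and s2: "norm s2 \<le> M" and l: "norm lam \<le> M"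
    have kM: "real k \<ge> M + 2" using k unfolding N_def by linarith
    define z where "z = of_nat (Suc k) + lam"
    have re: "Re (s1 + of_nat (Suc k)) \<ge> real (Suc k) - M" using abs_Re_le_cmod[of s1] s1 by simp
    have "norm (zeta (s1 + of_nat (Suc k)) - 1) \<le> K * 2 powr (- Re (s1 + of_nat (Suc k)))"
      using re kM by (intro K(2)) simp
    also have "\<dots> \<le> K * 2 powr (M - real k)"
      using re K(1) by (intro mult_left_mono powr_mono) auto
    also have "2 powr (M - real k) = 2 powr M * (1/2) ^ k"
      by (simp add: powr_diff powr_realpow power_divide)
    finally have 1: "norm (zeta (s1 + of_nat (Suc k)) - 1) \<le> K * 2 powr M * (1/2) ^ k"
      by (simp only: mult.assoc)
    have "norm (of_nat (Suc k) :: complex) - norm lam \<le> norm z" unfolding z_def by (rule norm_diff_ineq)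
    then have z1: "norm z \<ge> 1" using kM l unfolding norm_of_nat by simp
    have "norm z \<le> norm (of_nat (Suc k) :: complex) + norm lam" unfolding z_def by (rule norm_triangle_ineq)
    then have z2: "norm z \<le> real k + (1 + M)" using l unfolding norm_of_nat by simp
    have z0: "z \<noteq> 0" using z1 by auto
    have "norm (1 / z powr s2) = norm (exp (- s2 * Ln z))"
      using z0 by (simp add: powr_def exp_minus divide_inverse)
    also have "\<dots> \<le> exp (norm (- s2 * Ln z))" by (rule norm_exp)
    also have "norm (- s2 * Ln z) \<le> M * (ln (real k + (1 + M)) + pi)"
      unfolding norm_mult norm_minus_cancel using s2 M by (intro mult_mono norm_Ln_le z1 z2) auto
    also have "M * (ln (real k + (1 + M)) + pi) \<le> M * (\<bar>ln (real k + (1 + M))\<bar> + 2 * pi)"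
      using M pi_ge_zero by (intro mult_left_mono add_mono) auto
    also have "exp \<dots> \<le> G * exp (ln (3/2) * (real k + (1 + M)))" using M by (intro G(2)) auto
    also have "exp (ln (3/2) * (real k + (1 + M))) = (3/2) powr (real k + (1 + M))"
      by (simp add: powr_def mult.commute)
    also have "(3/2) powr (real k + (1 + M)) = (3/2) ^ k * (3/2) powr (1 + M)"
      by (simp only: powr_add[of _ "real k"]) (simp add: powr_realpow)
    finally have 2: "norm (1 / z powr s2) \<le> G * ((3/2) ^ k * (3/2) powr (1 + M))" by simp
    have "norm (D_term s1 s2 lam (Suc k)) = norm (zeta (s1 + of_nat (Suc k)) - 1) * norm (1 / z powr s2)"
      unfolding D_term_def z_def by (simp add: norm_mult norm_divide)
    also have "\<dots> \<le> (K * 2 powr M * (1/2) ^ k) * (G * ((3/2) ^ k * (3/2) powr (1 + M)))"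
      using K(1) by (intro mult_mono 1 2) auto
    also have "\<dots> = C * ((1/2) ^ k * (3/2) ^ k)" by (simp only: C_def mult_ac)
    also have "(1/2) ^ k * (3/2) ^ k = (3/4 :: real) ^ k" by (simp flip: power_mult_distrib)
    finally show "norm (D_term s1 s2 lam (Suc k)) \<le> C * (3/4) ^ k" .
  qed
qed

lemma summable_three_quarters: "summable (\<lambda>k. C * (3/4 :: real) ^ k)"
  by (intro summable_mult summable_geometric) simp

section \<open>Absolute convergence and joint holomorphy in s1 and s2\<close>

lemma summable_norm_D_term: "summable (\<lambda>k. norm (D_term s1 s2 lam (Suc k)))"
proof -
  define M where "M = norm s1 + norm s2 + norm lam"
  obtain C N where "C > 0" and CN: "\<And>k s1 s2 lam. k \<ge> N \<Longrightarrow> norm s1 \<le> M \<Longrightarrow> norm s2 \<le> M \<Longrightarrow> norm lam \<le> M \<Longrightarrow>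
      norm (D_term s1 s2 lam (Suc k)) \<le> C * (3/4) ^ k"
    using D_term_bound by blast
  show ?thesis
  proof (rule summable_comparison_test'[OF summable_three_quarters[of C], of N])
    fix k assume "k \<ge> N"
    then show "norm (norm (D_term s1 s2 lam (Suc k))) \<le> C * (3/4) ^ k"
      unfolding real_norm_def abs_norm_cancel by (intro CN) (auto simp: M_def)
  qed
qed

lemma D_term_sums: "(\<lambda>k. D_term s1 s2 lam (Suc k)) sums D_series s1 s2 lam"
  unfolding D_series_def by (rule summable_sums[OF summable_norm_cancel[OF summable_norm_D_term]])

lemma D_term_holomorphic_fst:
  "(\<lambda>s1. D_term s1 s2 lam (Suc k)) holomorphic_on - \<int>\<^sub>\<le>\<^sub>0"
proof -
  have "(\<lambda>s1. zeta (s1 + of_nat (Suc k))) holomorphic_on - \<int>\<^sub>\<le>\<^sub>0"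
  proof (rule holomorphic_on_compose_gen[OF _ zeta_holomorphic, unfolded o_def])
    show "(\<lambda>s1. s1 + of_nat (Suc k)) ` (- \<int>\<^sub>\<le>\<^sub>0) \<subseteq> - {1::complex}"
    proof safe
      fix s :: complex assume s: "s \<notin> \<int>\<^sub>\<le>\<^sub>0" "s + of_nat (Suc k) = 1"
      then have "s = - of_nat k" by (simp add: eq_neg_iff_add_eq_0)
      with s(1) show False by simp
    qed
  qed (intro holomorphic_intros)
  then show ?thesis unfolding D_term_def divide_inverse by (intro holomorphic_intros)
qed

lemma D_term_holomorphic_snd: "(\<lambda>s2. D_term s1 s2 lam (Suc k)) holomorphic_on A"
  \<comment> \<open>The denominator vanishes either for all \<open>s2\<close> or for none, according
    to whether the base is 0. In the degenerate case the quotient is constantly 0 by the convention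
    for division.\<close>
  unfolding D_term_def by (rule holomorphic_on_divide_gen) (auto intro!: holomorphic_intros)

lemma D_term_has_derivative:
  assumes "s1 \<notin> \<int>\<^sub>\<le>\<^sub>0"
  shows "((\<lambda>z. D_term (fst z) (snd z) lam (Suc k)) has_derivative
    (\<lambda>h. deriv (\<lambda>s. D_term s s2 lam (Suc k)) s1 * fst h + deriv (\<lambda>s. D_term s1 s lam (Suc k)) s2 * snd h)) (at (s1, s2))"
proof -
  \<comment> \<open>Setting s2 = 0 and lam = 0 makes the denominator 1, so this is the zeta factor,
    and its holomorphy is already available. Each term is a product of functions of separate
    variables.\<close>
  define \<phi> where "\<phi> = (\<lambda>s. D_term s 0 0 (Suc k))"
  define \<psi> where "\<psi> = (\<lambda>s. 1 / (of_nat (Suc k) + lam) powr s)"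
  have eq: "D_term s s' lam (Suc k) = \<phi> s * \<psi> s'" for s s'
    unfolding \<phi>_def \<psi>_def D_term_def by (simp del: of_nat_Suc)
  have "open (- \<int>\<^sub>\<le>\<^sub>0 :: complex set)" by (intro open_Compl closed_nonpos_Ints)
  then have \<phi>: "(\<phi> has_field_derivative deriv \<phi> s1) (at s1)"
    unfolding \<phi>_def using assms by (intro holomorphic_derivI[OF D_term_holomorphic_fst]) auto
  have "\<psi> holomorphic_on UNIV"
    unfolding \<psi>_def by (rule holomorphic_on_divide_gen) (auto intro!: holomorphic_intros)
  then have \<psi>: "(\<psi> has_field_derivative deriv \<psi> s2) (at s2)"
    by (intro holomorphic_derivI) auto
  have d1: "deriv (\<lambda>s. \<phi> s * \<psi> s2) s1 = deriv \<phi> s1 * \<psi> s2"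
    by (intro DERIV_imp_deriv DERIV_cmult_right \<phi>)
  have d2: "deriv (\<lambda>s. \<phi> s1 * \<psi> s) s2 = \<phi> s1 * deriv \<psi> s2"
    by (intro DERIV_imp_deriv DERIV_cmult \<psi>)
  have 1: "((\<lambda>z. \<phi> (fst z)) has_derivative (\<lambda>h. deriv \<phi> s1 * fst h)) (at (s1, s2))"
    using has_derivative_compose[OF has_derivative_fst[OF has_derivative_ident], of \<phi> "(*) (deriv \<phi> s1)" "(s1, s2)" UNIV] \<phi>
    by (simp add: has_field_derivative_def)
  have 2: "((\<lambda>z. \<psi> (snd z)) has_derivative (\<lambda>h. deriv \<psi> s2 * snd h)) (at (s1, s2))"
    using has_derivative_compose[OF has_derivative_snd[OF has_derivative_ident], of \<psi> "(*) (deriv \<psi> s2)" "(s1, s2)" UNIV] \<psi>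
    by (simp add: has_field_derivative_def)
  show ?thesis unfolding eq d1 d2
    by (rule has_derivative_eq_rhs[OF has_derivative_mult[OF 1 2]]) (simp add: fun_eq_iff mult_ac add_ac)
qed

text \<open>Differentiation term by term: Cauchy's estimate makes both partial derivatives of the
  terms geometrically small, so the derivatives of the partial sums converge uniformly as linear
  maps, and the limit is again complex linear.\<close>

lemma D_series_holomorphic2: "holomorphic2_on (\<lambda>s1 s2. D_series s1 s2 lam) ((- \<int>\<^sub>\<le>\<^sub>0) \<times> UNIV)"
  unfolding holomorphic2_on_def
proof
  fix x :: "complex \<times> complex" assume x: "x \<in> (- \<int>\<^sub>\<le>\<^sub>0) \<times> UNIV"
  obtain a b where ab: "x = (a, b)" by (cases x)
  have "open (- \<int>\<^sub>\<le>\<^sub>0 :: complex set)" by (intro open_Compl closed_nonpos_Ints)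
  then obtain d where d: "d > 0" "ball a d \<subseteq> - \<int>\<^sub>\<le>\<^sub>0" using x ab openE by blast
  define M where "M = norm a + norm b + norm lam + d"
  obtain C N where C: "C > 0" and CN: "\<And>k s1 s2 lam. k \<ge> N \<Longrightarrow> norm s1 \<le> M \<Longrightarrow> norm s2 \<le> M \<Longrightarrow> norm lam \<le> M \<Longrightarrow>
      norm (D_term s1 s2 lam (Suc k)) \<le> C * (3/4) ^ k"
    using D_term_bound by blast
  have bd: "norm (D_term s1 s2 lam (Suc k)) \<le> C * (3/4) ^ k" if "k \<ge> N" "s1 \<in> ball a d" "s2 \<in> ball b d" for k s1 s2
  proof (rule CN[OF that(1)])
    have "norm (s1 - a) < d" "norm (s2 - b) < d" using that by (auto simp: dist_norm norm_minus_commute)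
    then show "norm s1 \<le> M" "norm s2 \<le> M" "norm lam \<le> M"
      using norm_triangle_ineq[of a "s1 - a"] norm_triangle_ineq[of b "s2 - b"] d(1)
        norm_ge_zero[of a] norm_ge_zero[of b] norm_ge_zero[of lam]
      unfolding M_def add_diff_cancel_left' diff_add_cancel by (simp_all, linarith+)
  qed
  \<comment> \<open>The terms are bounded on the balls of radius \<open>d\<close>; half the radius
    leaves room for Cauchy's estimate.\<close>
  define S where "S = ball a (d/2) \<times> ball b (d/2)"
  define D1 where "D1 = (\<lambda>k z. deriv (\<lambda>s. D_term s (snd z) lam (Suc k)) (fst z))"
  define D2 where "D2 = (\<lambda>k z. deriv (\<lambda>s. D_term (fst z) s lam (Suc k)) (snd z))"
  have D1: "norm (D1 k z) \<le> 4 * C / d * (3/4) ^ k" if "k \<ge> N" "z \<in> S" for k z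
  proof -
    have "norm (D1 k z) \<le> 4 * (C * (3/4) ^ k) / d"
      unfolding D1_def using that d bd[OF that(1)]
      by (intro deriv_norm_le_of_bound[of _ a d] holomorphic_on_subset[OF D_term_holomorphic_fst]) (auto simp: S_def)
    then show ?thesis by simp
  qed
  have D2: "norm (D2 k z) \<le> 4 * C / d * (3/4) ^ k" if "k \<ge> N" "z \<in> S" for k z
  proof -
    have "norm (D2 k z) \<le> 4 * (C * (3/4) ^ k) / d"
      unfolding D2_def using that d bd[OF that(1)]
      by (intro deriv_norm_le_of_bound[of _ b d] D_term_holomorphic_snd) (auto simp: S_def)
    then show ?thesis by simp
  qed
  have "\<forall>\<^sub>F k in sequentially. \<forall>z\<in>S. norm (D1 k z) \<le> 4 * C / d * (3/4) ^ k"
    "\<forall>\<^sub>F k in sequentially. \<forall>z\<in>S. norm (D2 k z) \<le> 4 * C / d * (3/4) ^ k"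
    using D1 D2 unfolding eventually_sequentially by blast+
  note U = this[THEN Weierstrass_m_test_ev, OF summable_three_quarters]
  define g' where "g' = (\<lambda>z h. (\<Sum>k. D1 k z) * fst h + (\<Sum>k. D2 k z) * snd h)"
  have "\<exists>g. \<forall>z\<in>S. (\<lambda>k. D_term (fst z) (snd z) lam (Suc k)) sums g z \<and> (g has_derivative g' z) (at z within S)"
  proof (rule has_derivative_series[where f' = "\<lambda>k z h. D1 k z * fst h + D2 k z * snd h" and x = "(a, b)"])
    show "convex S" unfolding S_def by (intro convex_Times convex_ball)
    show "(a, b) \<in> S" using d(1) by (simp add: S_def)
    show "(\<lambda>k. D_term (fst (a, b)) (snd (a, b)) lam (Suc k)) sums D_series a b lam"
      using D_term_sums by simp
    show "((\<lambda>z. D_term (fst z) (snd z) lam (Suc k)) has_derivative (\<lambda>h. D1 k z * fst h + D2 k z * snd h)) (at z within S)"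
      if "z \<in> S" for k z
    proof (rule has_derivative_at_withinI)
      have "ball a (d/2) \<subseteq> ball a d" using d(1) by (intro subset_ball) simp
      then have "fst z \<notin> \<int>\<^sub>\<le>\<^sub>0" using that d(2) by (auto simp: S_def)
      from D_term_has_derivative[OF this, of lam k "snd z"]
      show "((\<lambda>z. D_term (fst z) (snd z) lam (Suc k)) has_derivative (\<lambda>h. D1 k z * fst h + D2 k z * snd h)) (at z)"
        unfolding D1_def D2_def by simp
    qed
    fix e :: real assume e: "e > 0"
    have "\<forall>\<^sub>F n in sequentially. \<forall>z\<in>S. dist (\<Sum>k<n. D1 k z) (\<Sum>k. D1 k z) < e/2"
      "\<forall>\<^sub>F n in sequentially. \<forall>z\<in>S. dist (\<Sum>k<n. D2 k z) (\<Sum>k. D2 k z) < e/2"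
      using U[THEN uniform_limitD, of "e/2"] e by auto
    then show "\<forall>\<^sub>F n in sequentially. \<forall>z\<in>S. \<forall>h. norm ((\<Sum>k<n. D1 k z * fst h + D2 k z * snd h) - g' z h) \<le> e * norm h"
    proof eventually_elim
      case (elim n)
      show ?case
      proof (intro ballI allI)
        fix z h assume z: "z \<in> S"
        let ?u = "(\<Sum>k<n. D1 k z) - (\<Sum>k. D1 k z)" and ?v = "(\<Sum>k<n. D2 k z) - (\<Sum>k. D2 k z)"
        have "(\<Sum>k<n. D1 k z * fst h + D2 k z * snd h) - g' z h = ?u * fst h + ?v * snd h"
          by (simp add: g'_def sum.distrib left_diff_distrib flip: sum_distrib_right)
        also have "norm \<dots> \<le> norm ?u * norm (fst h) + norm ?v * norm (snd h)"
          by (rule norm_triangle_le) (simp add: norm_mult)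
        also have "\<dots> \<le> e/2 * norm h + e/2 * norm h"
          using elim z norm_fst_le[of "fst h" "snd h"] norm_snd_le[of "snd h" "fst h"] e
          by (intro add_mono mult_mono) (auto simp: dist_norm intro: less_imp_le)
        finally show "norm ((\<Sum>k<n. D1 k z * fst h + D2 k z * snd h) - g' z h) \<le> e * norm h" by simp
      qed
    qed
  qed
  then obtain g where g: "\<And>z. z \<in> S \<Longrightarrow> (\<lambda>k. D_term (fst z) (snd z) lam (Suc k)) sums g z"
    "\<And>z. z \<in> S \<Longrightarrow> (g has_derivative g' z) (at z within S)" by blast
  have S: "open S" "x \<in> S" using d(1) by (auto simp: S_def ab open_Times)
  have "(g has_derivative g' x) (at x)" using g(2)[OF S(2)] at_within_open[OF S(2,1)] by simp
  moreover have "g z = D_series (fst z) (snd z) lam" if "z \<in> S" for z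
    using sums_unique2[OF g(1)[OF that] D_term_sums] .
  ultimately have "((\<lambda>z. D_series (fst z) (snd z) lam) has_derivative g' x) (at x)"
    by (rule has_derivative_transform_within_open[OF _ S])
  then have "((\<lambda>z. D_series (fst z) (snd z) lam) has_derivative g' x) (at x within (- \<int>\<^sub>\<le>\<^sub>0) \<times> UNIV)"
    by (rule has_derivative_at_withinI)
  then show "\<exists>a b. ((\<lambda>z. D_series (fst z) (snd z) lam) has_derivative (\<lambda>h. a * fst h + b * snd h)) (at x within (- \<int>\<^sub>\<le>\<^sub>0) \<times> UNIV)"
    unfolding g'_def by blast
qed

section \<open>Dependence on lam: holomorphy off the slit and limits from above\<close>

lemma D_term_bound_lam:
  obtains h where "summable h"
    "\<forall>\<^sub>F k in sequentially. \<forall>y\<in>ball lam 1. norm (D_term s1 s2 y (Suc k)) \<le> h k"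
proof -
  define M where "M = norm s1 + norm s2 + norm lam + 1"
  obtain C N where "C > 0" and CN: "\<And>k s1 s2 lam. k \<ge> N \<Longrightarrow> norm s1 \<le> M \<Longrightarrow> norm s2 \<le> M \<Longrightarrow> norm lam \<le> M \<Longrightarrow>
      norm (D_term s1 s2 lam (Suc k)) \<le> C * (3/4) ^ k"
    using D_term_bound by blast
  have "norm (D_term s1 s2 y (Suc k)) \<le> C * (3/4) ^ k" if "k \<ge> N" "y \<in> ball lam 1" for k y
  proof (rule CN[OF that(1)])
    have "norm (y - lam) < 1" using that by (auto simp: dist_norm norm_minus_commute)
    then have "norm y \<le> norm lam + 1" using norm_triangle_ineq[of lam "y - lam"] by simp
    then show "norm y \<le> M" using norm_ge_zero[of s1] norm_ge_zero[of s2] unfolding M_def by linarith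
  qed (auto simp: M_def)
  then have "\<forall>\<^sub>F k in sequentially. \<forall>y\<in>ball lam 1. norm (D_term s1 s2 y (Suc k)) \<le> C * (3/4) ^ k"
    unfolding eventually_sequentially by blast
  then show ?thesis by (rule that[OF summable_three_quarters])
qed

lemma D_series_holomorphic_lam:
  "(\<lambda>lam. D_series s1 s2 lam) holomorphic_on - (of_real ` {..-1})"
proof -
  let ?S = "- (complex_of_real ` {..-1})"
  have "complex_of_real ` {..-1} = \<real> \<inter> {z. Re z \<le> -1}"
    by (auto simp: Reals_def)
  then have "closed (complex_of_real ` {..-1})"
    by (simp add: closed_Int closed_complex_Reals closed_halfspace_Re_le)
  then have S: "open ?S" by (rule open_Compl)
  have hol: "(\<lambda>lam. D_term s1 s2 lam (Suc k)) holomorphic_on ?S" for k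
  proof -
    \<comment> \<open>As \<open>Suc k\<close> is at least 1, adding \<open>lam\<close> can reach the
      branch cut of the logarithm only if \<open>lam\<close> is real and at most -1.\<close>
    have slit: "of_nat (Suc k) + lam \<notin> \<real>\<^sub>\<le>\<^sub>0" if "lam \<in> ?S" for lam
    proof
      assume "of_nat (Suc k) + lam \<in> \<real>\<^sub>\<le>\<^sub>0"
      then have "Re lam \<le> -1" "Im lam = 0" by (auto simp: complex_nonpos_Reals_iff)
      then have "lam = of_real (Re lam)" by (simp add: complex_eq_iff)
      with \<open>Re lam \<le> -1\<close> that show False by (metis ComplD atMost_iff image_eqI)
    qed
    then have "of_nat (Suc k) + lam \<noteq> 0" if "lam \<in> ?S" for lam using that by (metis nonpos_Reals_zero_I)
    then show ?thesis unfolding D_term_def using slit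
      by (intro holomorphic_on_divide holomorphic_on_const holomorphic_on_powr holomorphic_on_add holomorphic_on_ident) auto
  qed
  have "\<exists>g g'. \<forall>x\<in>?S. (\<lambda>k. D_term s1 s2 x (Suc k)) sums g x \<and> (\<lambda>k. deriv (\<lambda>lam. D_term s1 s2 lam (Suc k)) x) sums g' x \<and>
      (g has_field_derivative g' x) (at x)"
  proof (rule series_and_derivative_comparison_local[OF S])
    show "((\<lambda>lam. D_term s1 s2 lam (Suc k)) has_field_derivative deriv (\<lambda>lam. D_term s1 s2 lam (Suc k)) x) (at x)"
      if "x \<in> ?S" for k x
      by (rule holomorphic_derivI[OF hol S that])
    fix x
    obtain h where "summable h" "\<forall>\<^sub>F k in sequentially. \<forall>y\<in>ball x 1. norm (D_term s1 s2 y (Suc k)) \<le> h k"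
      using D_term_bound_lam by blast
    then show "\<exists>d h. 0 < d \<and> summable h \<and> (\<forall>\<^sub>F k in sequentially. \<forall>y\<in>ball x d \<inter> ?S. norm (D_term s1 s2 y (Suc k)) \<le> h k)"
      by (intro exI[of _ 1] exI[of _ h]) (auto elim: eventually_mono)
  qed
  then obtain g g' where g: "\<And>x. x \<in> ?S \<Longrightarrow> (\<lambda>k. D_term s1 s2 x (Suc k)) sums g x"
    "\<And>x. x \<in> ?S \<Longrightarrow> (g has_field_derivative g' x) (at x)" by blast
  have "g holomorphic_on ?S"
    using g(2) by (auto simp: holomorphic_on_def field_differentiable_def intro: has_field_derivative_at_within)
  then show ?thesis
    by (rule holomorphic_transform) (rule sums_unique2[OF g(1) D_term_sums])
qed

text \<open>Multiplication by - i turns the closed upper half-plane into the closed right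
  half-plane, where, away from 0, the principal logarithm is continuous; the rotation costs the
  constant i pi / 2.\<close>

lemma tendsto_Ln_upper:
  assumes "Im z0 = 0" "z0 \<noteq> 0"
  shows "(Ln \<longlongrightarrow> Ln z0) (at z0 within {z. Im z > 0})"
proof -
  have eq: "Ln z = Ln (- \<i> * z) + \<i> * of_real pi / 2" if "Im z \<ge> 0" "z \<noteq> 0" for z
    using Ln_times_ii[of "- \<i> * z"] that by simp
  have "- \<i> * z0 \<notin> \<real>\<^sub>\<le>\<^sub>0" using assms by (auto simp: complex_nonpos_Reals_iff complex_eq_iff)
  then have "((\<lambda>z. Ln (- \<i> * z) + \<i> * of_real pi / 2) \<longlongrightarrow> Ln (- \<i> * z0) + \<i> * of_real pi / 2) (at z0 within {z. Im z > 0})"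
    by (intro tendsto_intros) auto
  then show ?thesis unfolding eq[OF eq_refl[OF assms(1)[symmetric]] assms(2), symmetric]
  proof (rule Lim_transform_eventually)
    show "\<forall>\<^sub>F z in at z0 within {z. Im z > 0}. Ln (- \<i> * z) + \<i> * of_real pi / 2 = Ln z"
      unfolding eventually_at_filter by (intro always_eventually allI impI eq[symmetric]) auto
  qed
qed

text \<open>Uniform convergence near \<open>x\<close> exchanges limit and sum. Because
  \<open>x\<close> is not an integer no base k + 1 + x vanishes, so each term has its limit from
  above. The majorant is local, hence the detour through a ball, which does not change the
  filter.\<close>

lemma D_series_tendsto_upper:
  assumes x: "x \<notin> \<int>"
  shows "((\<lambda>lam. D_series s1 s2 lam) \<longlongrightarrow> D_series s1 s2 (of_real x)) (at (of_real x) within {lam. Im lam > 0})"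
proof -
  let ?A = "ball (of_real x) 1 \<inter> {lam. Im lam > 0} :: complex set"
  obtain h where h: "summable h" "\<forall>\<^sub>F k in sequentially. \<forall>y\<in>ball (of_real x) 1. norm (D_term s1 s2 y (Suc k)) \<le> h k"
    using D_term_bound_lam by blast
  have lim: "((\<lambda>lam. D_term s1 s2 lam (Suc k)) \<longlongrightarrow> D_term s1 s2 (of_real x) (Suc k)) (at (of_real x) within {lam. Im lam > 0})" for k
  proof -
    let ?z0 = "of_nat (Suc k) + complex_of_real x"
    have z0: "?z0 \<noteq> 0"
    proof
      assume "?z0 = 0"
      then have "of_real (real (Suc k) + x) = (0 :: complex)" by simp
      then have "x = - real (Suc k)" unfolding of_real_eq_0_iff by simp
      then show False using x by simp
    qed
    have "filterlim (\<lambda>lam. of_nat (Suc k) + lam) (at ?z0 within {z. Im z > 0}) (at (of_real x) within {lam. Im lam > 0})"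
      by (rule filterlim_at_withinI)
         (auto intro!: tendsto_intros simp: eventually_at_filter)
    from filterlim_compose[OF tendsto_Ln_upper this] z0
    have L: "((\<lambda>lam. Ln (of_nat (Suc k) + lam)) \<longlongrightarrow> Ln ?z0) (at (of_real x) within {lam. Im lam > 0})" by simp
    have T: "((\<lambda>lam. (zeta (s1 + of_nat (Suc k)) - 1) / exp (s2 * Ln (of_nat (Suc k) + lam))) \<longlongrightarrow>
       (zeta (s1 + of_nat (Suc k)) - 1) / exp (s2 * Ln ?z0)) (at (of_real x) within {lam. Im lam > 0})"
      by (intro tendsto_divide tendsto_const tendsto_exp tendsto_mult L) simp
    have D0: "D_term s1 s2 (of_real x) (Suc k) = (zeta (s1 + of_nat (Suc k)) - 1) / exp (s2 * Ln ?z0)"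
      using z0 unfolding D_term_def powr_def by simp
    have "\<forall>\<^sub>F lam in at (of_real x) within {lam. Im lam > 0}.
       (zeta (s1 + of_nat (Suc k)) - 1) / exp (s2 * Ln (of_nat (Suc k) + lam)) = D_term s1 s2 lam (Suc k)"
      unfolding eventually_at_filter D_term_def powr_def
      by (auto intro!: always_eventually simp: complex_eq_iff)
    then show ?thesis unfolding D0 by (rule Lim_transform_eventually[OF T])
  qed
  have "((\<lambda>lam. \<Sum>k. D_term s1 s2 lam (Suc k)) \<longlongrightarrow> D_series s1 s2 (of_real x)) (at (of_real x) within ?A)"
  proof (rule swap_uniform_limit)
    show "\<forall>\<^sub>F n in sequentially. ((\<lambda>lam. \<Sum>k<n. D_term s1 s2 lam (Suc k)) \<longlongrightarrow> (\<Sum>k<n. D_term s1 s2 (of_real x) (Suc k))) (at (of_real x) within ?A)"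
      using lim by (intro always_eventually allI tendsto_sum) (auto intro: tendsto_within_subset)
    show "(\<lambda>n. \<Sum>k<n. D_term s1 s2 (of_real x) (Suc k)) \<longlonglongrightarrow> D_series s1 s2 (of_real x)"
      using D_term_sums unfolding sums_def .
    show "uniform_limit ?A (\<lambda>n lam. \<Sum>k<n. D_term s1 s2 lam (Suc k)) (\<lambda>lam. \<Sum>k. D_term s1 s2 lam (Suc k)) sequentially"
      using h by (intro Weierstrass_m_test_ev[of _ _ h]) (auto elim: eventually_mono)
  qed simp
  also have "at (of_real x) within ?A = at (of_real x) within {lam. Im lam > 0}"
    by (rule at_within_nhd[of _ "ball (of_real x) 1"]) auto
  finally show ?thesis unfolding D_series_def .
qed

theorem theorem2p1:
  fixes lam :: complex
  assumes "lam \<notin> of_int ` {..<0}"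
  shows "(\<forall>s1 s2. s1 \<notin> \<int>\<^sub>\<le>\<^sub>0 \<longrightarrow> summable (\<lambda>k. norm (D_term s1 s2 lam (Suc k)))) \<and>
    (Re lam > -1 \<longrightarrow>
      (\<exists>\<epsilon>>0. \<forall>rv\<in>{0<..<\<epsilon>}. \<forall>rw\<in>{0<..<\<epsilon>}. \<forall>s1 s2. s1 \<notin> \<int>\<^sub>\<le>\<^sub>0 \<longrightarrow>
         double_hankel_converges rv rw s1 s2 lam \<and>
         (s1 \<notin> \<int> \<longrightarrow> s2 \<notin> of_nat ` {1..} \<longrightarrow>
            D_series s1 s2 lam = hankel_rep rv rw s1 s2 lam))) \<and>
    (\<exists>R. rep_extension R \<and>
      (\<forall>s1 s2. s1 \<notin> \<int>\<^sub>\<le>\<^sub>0 \<longrightarrow> D_series s1 s2 lam = R s1 s2 lam) \<and>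
      holomorphic2_on (\<lambda>s1 s2. R s1 s2 lam) ((- \<int>\<^sub>\<le>\<^sub>0) \<times> UNIV))"
proof (intro conjI)
  show "\<forall>s1 s2. s1 \<notin> \<int>\<^sub>\<le>\<^sub>0 \<longrightarrow> summable (\<lambda>k. norm (D_term s1 s2 lam (Suc k)))"
    using summable_norm_D_term by blast
  show "Re lam > -1 \<longrightarrow>
      (\<exists>\<epsilon>>0. \<forall>rv\<in>{0<..<\<epsilon>}. \<forall>rw\<in>{0<..<\<epsilon>}. \<forall>s1 s2. s1 \<notin> \<int>\<^sub>\<le>\<^sub>0 \<longrightarrow>
         double_hankel_converges rv rw s1 s2 lam \<and>
         (s1 \<notin> \<int> \<longrightarrow> s2 \<notin> of_nat ` {1..} \<longrightarrow>
            D_series s1 s2 lam = hankel_rep rv rw s1 s2 lam))"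
    \<comment> \<open>Below the radius 1/4 both the lower bound on exp z - 1 and the bound 4/3 on
      exp (- w) are available.\<close>
    by (intro impI exI[of _ "1/4"] conjI ballI allI hankel_outer(1) D_series_eq_hankel_rep) auto
  have "rep_extension D_series"
    unfolding rep_extension_def
  proof (intro conjI)
    show "\<exists>\<epsilon>>0. \<forall>rv\<in>{0<..<\<epsilon>}. \<forall>rw\<in>{0<..<\<epsilon>}. \<forall>s1 s2 lam.
        s1 \<notin> \<int> \<longrightarrow> s2 \<notin> of_nat ` {1..} \<longrightarrow> Re lam > -1 \<longrightarrow>
        D_series s1 s2 lam = hankel_rep rv rw s1 s2 lam"
      by (intro exI[of _ "1/4"] conjI ballI allI impI D_series_eq_hankel_rep) auto
  qed (auto intro: D_series_holomorphic2 D_series_holomorphic_lam D_series_tendsto_upper)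
  then show "\<exists>R. rep_extension R \<and>
      (\<forall>s1 s2. s1 \<notin> \<int>\<^sub>\<le>\<^sub>0 \<longrightarrow> D_series s1 s2 lam = R s1 s2 lam) \<and>
      holomorphic2_on (\<lambda>s1 s2. R s1 s2 lam) ((- \<int>\<^sub>\<le>\<^sub>0) \<times> UNIV)"
    using D_series_holomorphic2 by blast
qed

end
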